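(* Let $\mathbb{X}\subseteq\mathbb{P}^{n_1}\times\cdots\times\mathbb{P}^{n_r}$ be a finite set of points. If $\mathbb{X}$ is arithmetically Cohen-Macaulay, then $|\deg_{\mathbb{X}}(P)|=1$ for every point $P\in\mathbb{X}$.
   Context: $k$ is an algebraically closed field of characteristic zero, projective spaces are over $k$, and $r,n_1,\ldots,n_r\ge 1$. $\mathbb{N}=\{0,1,2,\ldots\}$. The coordinate ring of $\mathbb{P}^{n_1}\times\cdots\times\mathbb{P}^{n_r}$ is the $\mathbb{N}^r$-graded ring $R=k[x_{1,0},\ldots,x_{1,n_1},\ldots,x_{r,0},\ldots,x_{r,n_r}]$ with $\deg x_{i,j}=e_i$, the $i$th standard basis vector of $\mathbb{N}^r$. For a finite set of points $\mathbb{X}$, $I_{\mathbb{X}}\subseteq R$ is the ideal generated by all multihomogeneous forms vanishing at all points of $\mathbb{X}$. The set $\mathbb{X}$ is arithmetically Cohen-Macaulay (ACM) if $\dim R/I_{\mathbb{X}}=\operatorname{depth}R/I_{\mathbb{X}}=r$, i.e. $R/I_{\mathbb{X}}$ is Cohen-Macaulay (depth with respect to the ideal generated by all the variables). $\mathbb{N}^r$ carries the partial order $(a_1,\ldots,a_r)\succeq(b_1,\ldots,b_r)$ iff $a_i\ge b_i$ for all $i$. For a subset $S\subseteq\mathbb{N}^r$, $\min S$ is the set of minimal elements of $S$ with respect to this order. For $P\in\mathbb{X}$, a multihomogeneous form $F\in R$ is a separator for $P$ if $F(P)\neq 0$ and $F(Q)=0$ for all $Q\in\mathbb{X}\setminus\{P\}$.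 The degree of the point $P\in\mathbb{X}$ is the set $\deg_{\mathbb{X}}(P)=\min\{\deg F \mid F\text{ is a separator for }P\in\mathbb{X}\}\subseteq\mathbb{N}^r$. *)

theory Defs
  imports
    "HOL-Algebra.QuotRing"
    "HOL-Library.Poly_Mapping"
    "HOL-Library.Extended_Nat"
    "HOL-Computational_Algebra.Polynomial"
begin

section \<open>The multigraded coordinate ring\<close>

text \<open>
  The variable x_{i,j} is the pair (i,j). A polynomial is a finitely supported map from monomials
  to coefficients, a monomial being a finitely supported exponent map on the variables.
  Multiplication on the type of polynomials is convolution.
\<close>

type_synonym mvar = "nat \<times> nat"
type_synonym 'k mpoly = "(mvar \<Rightarrow>\<^sub>0 nat) \<Rightarrow>\<^sub>0 'k"

definition mvars :: "nat \<Rightarrow> (nat \<Rightarrow> nat) \<Rightarrow> mvar set" where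
  "mvars r n = (SIGMA i:{1..r}. {0..n i})"

definition mvar :: "mvar \<Rightarrow> 'k::comm_ring_1 mpoly" where
  "mvar x = Poly_Mapping.single (Poly_Mapping.single x 1) 1"

definition coord_ring :: "nat \<Rightarrow> (nat \<Rightarrow> nat) \<Rightarrow> 'k::comm_ring_1 mpoly ring" where
  "coord_ring r n =
     \<lparr>carrier = {F. \<forall>m \<in> Poly_Mapping.keys F. Poly_Mapping.keys m \<subseteq> mvars r n},
      monoid.mult = (*), one = 1, zero = 0, add = (+)\<rparr>"

definition mp_eval :: "(mvar \<Rightarrow> 'k) \<Rightarrow> 'k::comm_ring_1 mpoly \<Rightarrow> 'k" where
  "mp_eval a F = (\<Sum>m \<in> Poly_Mapping.keys F.
     Poly_Mapping.lookup F m * (\<Prod>x \<in> Poly_Mapping.keys m. a x ^ Poly_Mapping.lookup m x))"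

text \<open>
  Elements of N^r are represented by functions on all natural numbers that vanish outside {1..r};
  the pointwise order of functions is then the product order of N^r. Multidegrees of monomials of
  the coordinate ring have this form.
\<close>

definition mdeg :: "(mvar \<Rightarrow>\<^sub>0 nat) \<Rightarrow> (nat \<Rightarrow> nat)" where
  "mdeg m = (\<lambda>i. \<Sum>x | x \<in> Poly_Mapping.keys m \<and> fst x = i. Poly_Mapping.lookup m x)"

text \<open>As usual, the zero form is multihomogeneous of every degree.\<close>

definition multiform :: "nat \<Rightarrow> (nat \<Rightarrow> nat) \<Rightarrow> (nat \<Rightarrow> nat) \<Rightarrow> 'k::comm_ring_1 mpoly \<Rightarrow> bool" where
  "multiform r n d F \<longleftrightarrow>
     F \<in> carrier (coord_ring r n) \<and> (\<forall>m \<in> Poly_Mapping.keys F. mdeg m = d)"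

section \<open>Points of a product of projective spaces\<close>

definition nonzero_vecs :: "nat \<Rightarrow> (nat \<Rightarrow> 'k::field) set" where
  "nonzero_vecs n = {v \<in> {0..n} \<rightarrow>\<^sub>E UNIV. \<exists>j \<in> {0..n}. v j \<noteq> 0}"

definition proportional :: "nat \<Rightarrow> ((nat \<Rightarrow> 'k::field) \<times> (nat \<Rightarrow> 'k)) set" where
  "proportional n = {(v, w). v \<in> nonzero_vecs n \<and> w \<in> nonzero_vecs n \<and>
     (\<exists>c. c \<noteq> 0 \<and> (\<forall>j \<in> {0..n}. w j = c * v j))}"

definition proj_space :: "nat \<Rightarrow> (nat \<Rightarrow> 'k::field) set set" where
  "proj_space n = nonzero_vecs n // proportional n"

type_synonym 'k mpoint = "nat \<Rightarrow> (nat \<Rightarrow> 'k) set"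

definition multiproj_space :: "nat \<Rightarrow> (nat \<Rightarrow> nat) \<Rightarrow> 'k::field mpoint set" where
  "multiproj_space r n = (\<Pi>\<^sub>E i \<in> {1..r}. proj_space (n i))"

text \<open>
  Vanishing is tested on all representatives of the point; for a multihomogeneous form one
  representative decides, by the lemma \<open>multiform_vanishes_iff\<close> below.
\<close>

definition vanishes_at :: "nat \<Rightarrow> 'k::field mpoly \<Rightarrow> 'k mpoint \<Rightarrow> bool" where
  "vanishes_at r F P \<longleftrightarrow> (\<forall>v. (\<forall>i \<in> {1..r}. v i \<in> P i) \<longrightarrow> mp_eval (\<lambda>(i, j). v i j) F = 0)"

definition vanishing_ideal ::
    "nat \<Rightarrow> (nat \<Rightarrow> nat) \<Rightarrow> 'k::field mpoint set \<Rightarrow> 'k mpoly set" where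
  "vanishing_ideal r n X =
     genideal (coord_ring r n) {F. (\<exists>d. multiform r n d F) \<and> (\<forall>P \<in> X. vanishes_at r F P)}"

section \<open>Dimension, depth and the Cohen-Macaulay property\<close>

text \<open>
  In both definitions below the supremum over the empty set, which is 0, arises for the zero ring;
  no convention about that ring matters for \<open>ACM\<close> when r is positive.
\<close>

definition krull_dim :: "('a, 'b) ring_scheme \<Rightarrow> enat" where
  "krull_dim A = Sup {enat d | d. \<exists>C :: nat \<Rightarrow> 'a set.
     (\<forall>i \<le> d. primeideal (C i) A) \<and> (\<forall>i < d. C i \<subset> C (Suc i))}"

text \<open>
  Each element is a nonzerodivisor modulo its predecessors, and the quotient by all of them
  is nonzero.
\<close>

definition regular_seq :: "('a, 'b) ring_scheme \<Rightarrow> 'a list \<Rightarrow> bool" where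
  "regular_seq A xs \<longleftrightarrow> set xs \<subseteq> carrier A \<and>
     (\<forall>i < length xs. \<forall>a \<in> carrier A.
        xs ! i \<otimes>\<^bsub>A\<^esub> a \<in> genideal A (set (take i xs)) \<longrightarrow> a \<in> genideal A (set (take i xs))) \<and>
     genideal A (set xs) \<noteq> carrier A"

definition ring_depth :: "('a, 'b) ring_scheme \<Rightarrow> 'a set \<Rightarrow> enat" where
  "ring_depth A J = Sup {enat (length xs) | xs. regular_seq A xs \<and> set xs \<subseteq> J}"

text \<open>The quotient of the coordinate ring by the vanishing ideal, and its ideal generated by the
  residue classes of the variables.\<close>

definition point_ring :: "nat \<Rightarrow> (nat \<Rightarrow> nat) \<Rightarrow> 'k::field mpoint set \<Rightarrow> 'k mpoly set ring" where
  "point_ring r n X = coord_ring r n Quot vanishing_ideal r n X"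

definition irrelevant_ideal ::
    "nat \<Rightarrow> (nat \<Rightarrow> nat) \<Rightarrow> 'k::field mpoint set \<Rightarrow> 'k mpoly set set" where
  "irrelevant_ideal r n X = genideal (point_ring r n X)
     ((\<lambda>x. vanishing_ideal r n X +>\<^bsub>coord_ring r n\<^esub> mvar x) ` mvars r n)"

definition ACM :: "nat \<Rightarrow> (nat \<Rightarrow> nat) \<Rightarrow> 'k::field mpoint set \<Rightarrow> bool" where
  "ACM r n X \<longleftrightarrow>
     krull_dim (point_ring r n X) = enat r \<and>
     ring_depth (point_ring r n X) (irrelevant_ideal r n X) = enat r"

section \<open>Separators and the degree of a point\<close>

definition separator ::
    "nat \<Rightarrow> (nat \<Rightarrow> nat) \<Rightarrow> 'k::field mpoint set \<Rightarrow> 'k mpoint \<Rightarrow> (nat \<Rightarrow> nat) \<Rightarrow> 'k mpoly \<Rightarrow> bool" where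
  "separator r n X P d F \<longleftrightarrow>
     multiform r n d F \<and> \<not> vanishes_at r F P \<and> (\<forall>Q \<in> X - {P}. vanishes_at r F Q)"

definition min_elems :: "'a::order set \<Rightarrow> 'a set" where
  "min_elems S = {d \<in> S. \<forall>e \<in> S. e \<le> d \<longrightarrow> e = d}"

definition point_degree ::
    "nat \<Rightarrow> (nat \<Rightarrow> nat) \<Rightarrow> 'k::field mpoint set \<Rightarrow> 'k mpoint \<Rightarrow> (nat \<Rightarrow> nat) set" where
  "point_degree r n X P = min_elems {d. \<exists>F. separator r n X P d F}"

section \<open>Well-definedness\<close>

lemma cring_coord_ring: "cring (coord_ring r n :: 'k::comm_ring_1 mpoly ring)"
proof (rule cringI)
  let ?R = "coord_ring r n :: 'k mpoly ring"
  show "abelian_group ?R"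
  proof (rule abelian_groupI)
    fix x y assume "x \<in> carrier ?R" "y \<in> carrier ?R"
    then show "x \<oplus>\<^bsub>?R\<^esub> y \<in> carrier ?R"
      using Poly_Mapping.keys_add[of x y] by (auto simp: coord_ring_def)
  next
    fix x assume "x \<in> carrier ?R"
    then show "\<exists>y \<in> carrier ?R. y \<oplus>\<^bsub>?R\<^esub> x = \<zero>\<^bsub>?R\<^esub>"
      by (intro bexI[of _ "- x"]) (auto simp: coord_ring_def)
  qed (auto simp: coord_ring_def algebra_simps)
  show "comm_monoid ?R"
  proof (rule comm_monoidI)
    fix x y assume xy: "x \<in> carrier ?R" "y \<in> carrier ?R"
    have "Poly_Mapping.keys m \<subseteq> mvars r n" if m: "m \<in> Poly_Mapping.keys (x * y)" for m
    proof -
      from m keys_mult[of x y] obtain a b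
        where ab: "a \<in> Poly_Mapping.keys x" "b \<in> Poly_Mapping.keys y" "m = a + b" by auto
      have "Poly_Mapping.keys a \<subseteq> mvars r n" "Poly_Mapping.keys b \<subseteq> mvars r n"
        using ab xy by (auto simp: coord_ring_def)
      then show ?thesis using Poly_Mapping.keys_add[of a b] ab(3) by blast
    qed
    then show "x \<otimes>\<^bsub>?R\<^esub> y \<in> carrier ?R" by (simp add: coord_ring_def)
  qed (auto simp: coord_ring_def algebra_simps)
qed (auto simp: coord_ring_def algebra_simps)

lemma equiv_proportional: "equiv (nonzero_vecs n) (proportional n)"
proof (rule equivI)
  show "refl_on (nonzero_vecs n) (proportional n)"
    by (auto simp: refl_on_def proportional_def intro!: exI[of _ 1])
  show "sym (proportional n)"
  proof (rule symI)
    fix v w assume "(v, w) \<in> proportional n"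
    then obtain c where "v \<in> nonzero_vecs n" "w \<in> nonzero_vecs n" "c \<noteq> 0"
      "\<forall>j \<in> {0..n}. w j = c * v j" by (auto simp: proportional_def)
    then show "(w, v) \<in> proportional n"
      unfolding proportional_def by (auto intro!: exI[of _ "inverse c"])
  qed
  show "trans (proportional n)"
  proof (rule transI)
    fix u v w assume "(u, v) \<in> proportional n" "(v, w) \<in> proportional n"
    then obtain c d where "u \<in> nonzero_vecs n" "w \<in> nonzero_vecs n" "c \<noteq> 0" "d \<noteq> 0"
      "\<forall>j \<in> {0..n}. v j = c * u j" "\<forall>j \<in> {0..n}. w j = d * v j" by (auto simp: proportional_def)
    then show "(u, w) \<in> proportional n"
      unfolding proportional_def by (auto intro!: exI[of _ "d * c"])
  qed
  show "proportional n \<subseteq> nonzero_vecs n \<times> nonzero_vecs n"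
    by (auto simp: proportional_def)
qed

lemma mp_eval_scale:
  fixes F :: "'k::field mpoly"
  assumes F: "multiform r n d F"
    and w: "\<And>i j. i \<in> {1..r} \<Longrightarrow> j \<in> {0..n i} \<Longrightarrow> w i j = c i * v i j"
  shows "mp_eval (\<lambda>(i, j). w i j) F = (\<Prod>i \<in> {1..r}. c i ^ d i) * mp_eval (\<lambda>(i, j). v i j) F"
proof -
  have "(\<Prod>x \<in> Poly_Mapping.keys m. (case x of (i, j) \<Rightarrow> w i j) ^ Poly_Mapping.lookup m x) =
      (\<Prod>i \<in> {1..r}. c i ^ d i) *
      (\<Prod>x \<in> Poly_Mapping.keys m. (case x of (i, j) \<Rightarrow> v i j) ^ Poly_Mapping.lookup m x)"
    if m: "m \<in> Poly_Mapping.keys F" for m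
  proof -
    let ?K = "Poly_Mapping.keys m" and ?l = "Poly_Mapping.lookup m"
    have K: "?K \<subseteq> mvars r n" and d: "mdeg m = d"
      using F m by (auto simp: multiform_def coord_ring_def)
    have "(\<Prod>x \<in> ?K. (case x of (i, j) \<Rightarrow> w i j) ^ ?l x) =
        (\<Prod>x \<in> ?K. c (fst x) ^ ?l x * (case x of (i, j) \<Rightarrow> v i j) ^ ?l x)"
      using K w by (intro prod.cong) (auto simp: mvars_def power_mult_distrib)
    also have "\<dots> = (\<Prod>x \<in> ?K. c (fst x) ^ ?l x) *
        (\<Prod>x \<in> ?K. (case x of (i, j) \<Rightarrow> v i j) ^ ?l x)"
      by (simp add: prod.distrib)
    also have "(\<Prod>x \<in> ?K. c (fst x) ^ ?l x) =
        (\<Prod>i \<in> {1..r}. \<Prod>x \<in> {x \<in> ?K. fst x = i}. c (fst x) ^ ?l x)"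
      using K by (intro prod.group[symmetric]) (auto simp: mvars_def)
    also have "\<dots> = (\<Prod>i \<in> {1..r}. c i ^ d i)"
      by (intro prod.cong refl) (simp add: d[symmetric] mdeg_def power_sum)
    finally show ?thesis .
  qed
  then show ?thesis
    by (simp add: mp_eval_def sum_distrib_left mult.left_commute)
qed

lemma multiform_vanishes_iff:
  fixes P :: "'k::field mpoint"
  assumes F: "multiform r n d F" and P: "P \<in> multiproj_space r n"
    and v: "\<And>i. i \<in> {1..r} \<Longrightarrow> v i \<in> P i"
  shows "vanishes_at r F P \<longleftrightarrow> mp_eval (\<lambda>(i, j). v i j) F = 0"
proof
  assume "vanishes_at r F P"
  then show "mp_eval (\<lambda>(i, j). v i j) F = 0" using v by (auto simp: vanishes_at_def)
next
  assume 0: "mp_eval (\<lambda>(i, j). v i j) F = 0"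
  show "vanishes_at r F P" unfolding vanishes_at_def
  proof (intro allI impI)
    fix w assume w: "\<forall>i \<in> {1..r}. w i \<in> P i"
    have "\<exists>c. \<forall>j \<in> {0..n i}. w i j = c * v i j" if i: "i \<in> {1..r}" for i
    proof -
      have "P i \<in> nonzero_vecs (n i) // proportional (n i)"
        using P i by (auto simp: multiproj_space_def proj_space_def)
      then have "(v i, w i) \<in> proportional (n i)"
        using quotient_eq_iff[OF equiv_proportional] v[OF i] w i by blast
      then show ?thesis by (auto simp: proportional_def)
    qed
    then obtain c where "\<And>i j. i \<in> {1..r} \<Longrightarrow> j \<in> {0..n i} \<Longrightarrow> w i j = c i * v i j"
      by metis
    from mp_eval_scale[OF F this] 0 show "mp_eval (\<lambda>(i, j). w i j) F = 0" by simp
  qed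
qed

end

theory Submission
  imports Defs
begin

text \<open>
  Fix a point \<open>P\<close> of \<open>X\<close> and let \<open>D\<close> be the set of degrees of separators of \<open>P\<close>. The claim is that
  \<open>D\<close> has a least element. It is nonempty (lemma \<open>exists_separator\<close>). Over an infinite field there are linear forms \<open>L\<^sub>i\<close> of degree \<open>e\<^sub>i\<close> that vanish
  at no point of \<open>X\<close>; multiplying by them shows that \<open>D\<close> is closed under adding a unit vector. Hence
  \<open>D\<close> is closed under componentwise minima, and therefore has a least element, as soon as

    (1)  \<open>m + e\<^sub>i \<in> D\<close> and \<open>m + e\<^sub>j \<in> D\<close> with \<open>i \<noteq> j\<close> imply \<open>m \<in> D\<close>

  (lemmas \<open>exchange_closed_meet\<close> and \<open>card_min_elems_eq_1\<close>).

  The Cohen-Macaulay property gives (1) as follows. Let \<open>F\<close> and \<open>G\<close> be separators of degrees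
  \<open>m + e\<^sub>i\<close> and \<open>m + e\<^sub>j\<close>. After rescaling, \<open>L\<^sub>j F - L\<^sub>i G\<close> vanishes on \<open>X\<close>. If \<open>L\<^sub>i, L\<^sub>j\<close> behave like a
  regular sequence modulo the ideal \<open>I\<close> of \<open>X\<close>, then \<open>F\<close> is \<open>L\<^sub>i H\<close> modulo \<open>I\<close>, and \<open>H\<close> is a separator
  of degree \<open>m\<close> (lemma \<open>separator_meet\<close>).

  The hypothesis only provides some regular sequence \<open>y\<^sub>1, \<dots>, y\<^sub>r\<close> of possibly inhomogeneous elements
  of the irrelevant ideal. The passage to the forms \<open>L\<^sub>k\<close> uses that Koszul homology detects depth.
  Since no \<open>L\<^sub>k\<close> vanishes at a point of \<open>X\<close>, every variable has a power in \<open>I + (L\<^sub>1, \<dots>, L\<^sub>r)\<close>: the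
  product over \<open>Q \<in> X\<close> of the forms \<open>x - \<lambda>\<^sub>Q L\<close>, each vanishing at its \<open>Q\<close>, lies in \<open>I\<close>
  (lemma \<open>var_power_mod\<close>). So some power of each \<open>y\<^sub>s\<close> acts as zero on the homology of the Koszul
  complex of \<open>L\<^sub>1, \<dots>, L\<^sub>r\<close>. Passing to the quotient by one \<open>y\<^sub>s\<close> after the other moves a class in
  homological degree 1 up to degree \<open>r + 1\<close>, where there are no chains; hence the first Koszul
  homology over the coordinate ring modulo \<open>I\<close> is zero (theorem \<open>regular_sequence_koszul_exact\<close>).

  In (1) this is applied to the sequence in which each \<open>L\<^sub>k\<close> with \<open>k \<noteq> i, j\<close> is replaced by a power of
  degree greater than \<open>m k\<close>. Exactness writes \<open>F\<close> as \<open>L\<^sub>i h\<close> plus multiples of these powers modulo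
  \<open>I\<close>, and the multiples have no component in degree \<open>m + e\<^sub>i\<close>. This replaces the usual graded
  Nakayama argument for removing elements from a Koszul complex.
\<close>

section \<open>Ideals and regular sequences\<close>

text \<open>
  The coordinate ring is a subring of a ring given as a type, so its operations are those of the type.
  This locale describes such a subring \<open>C\<close> by closure properties and allows calculations with the
  operations of the type class; \<open>is_ideal\<close> below means an ideal of \<open>C\<close>.
\<close>

locale ring_subset =
  fixes C :: "'a::comm_ring_1 set"
  assumes one_closed: "1 \<in> C"
    and diff_closed: "a \<in> C \<Longrightarrow> b \<in> C \<Longrightarrow> a - b \<in> C"
    and mult_closed: "a \<in> C \<Longrightarrow> b \<in> C \<Longrightarrow> a * b \<in> C"
begin

definition is_ideal :: "'a set \<Rightarrow> bool" where
  "is_ideal J \<longleftrightarrow> J \<subseteq> C \<and> 0 \<in> J \<and> (\<forall>a \<in> J. \<forall>b \<in> J. a - b \<in> J) \<and> (\<forall>c \<in> C. \<forall>a \<in> J. c * a \<in> J)"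

lemma zero_closed: "0 \<in> C" using one_closed diff_closed by fastforce
lemma uminus_closed: "a \<in> C \<Longrightarrow> - a \<in> C" using zero_closed diff_closed by fastforce
lemma add_closed: "a \<in> C \<Longrightarrow> b \<in> C \<Longrightarrow> a + b \<in> C"
  using uminus_closed diff_closed by (metis diff_minus_eq_add)
lemma power_closed: "a \<in> C \<Longrightarrow> a ^ n \<in> C"
  by (induction n) (auto simp: one_closed mult_closed)
lemma sum_closed: "(\<And>x. x \<in> A \<Longrightarrow> f x \<in> C) \<Longrightarrow> (\<Sum>x \<in> A. f x) \<in> C"
  by (induction A rule: infinite_finite_induct) (auto simp: zero_closed add_closed)
lemma prod_closed: "(\<And>x. x \<in> S \<Longrightarrow> f x \<in> C) \<Longrightarrow> (\<Prod>x \<in> S. f x) \<in> C"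
  by (induction S rule: infinite_finite_induct) (auto simp: one_closed mult_closed)

lemmas closed = zero_closed one_closed uminus_closed add_closed diff_closed mult_closed power_closed
  sum_closed

lemma is_ideal_carrier: "is_ideal C" by (simp add: is_ideal_def closed)

lemma ideal_subset: "is_ideal J \<Longrightarrow> a \<in> J \<Longrightarrow> a \<in> C" by (auto simp: is_ideal_def)
lemma ideal_zero: "is_ideal J \<Longrightarrow> 0 \<in> J" by (auto simp: is_ideal_def)
lemma ideal_diff: "is_ideal J \<Longrightarrow> a \<in> J \<Longrightarrow> b \<in> J \<Longrightarrow> a - b \<in> J" by (auto simp: is_ideal_def)
lemma ideal_mult: "is_ideal J \<Longrightarrow> c \<in> C \<Longrightarrow> a \<in> J \<Longrightarrow> c * a \<in> J" by (auto simp: is_ideal_def)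
lemma ideal_uminus: "is_ideal J \<Longrightarrow> a \<in> J \<Longrightarrow> - a \<in> J" 
  using ideal_diff[of J 0 a] ideal_zero by simp
lemma ideal_add: "is_ideal J \<Longrightarrow> a \<in> J \<Longrightarrow> b \<in> J \<Longrightarrow> a + b \<in> J"
  using ideal_diff[of J a "- b"] ideal_uminus by simp
lemma ideal_sum: "is_ideal J \<Longrightarrow> (\<And>x. x \<in> A \<Longrightarrow> f x \<in> J) \<Longrightarrow> (\<Sum>x \<in> A. f x) \<in> J"
  by (induction A rule: infinite_finite_induct) (auto simp: ideal_zero ideal_add)

lemmas ideal_closed = ideal_zero ideal_uminus ideal_add ideal_diff ideal_mult ideal_sum

definition adjoin :: "'a set \<Rightarrow> 'a \<Rightarrow> 'a set" where
  "adjoin J y = {j + y * c | j c. j \<in> J \<and> c \<in> C}"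

lemma is_ideal_linear_span:
  assumes E: "finite E" and l: "l ` E \<subseteq> C" and J: "is_ideal J"
  shows "is_ideal {x \<in> C. \<exists>c. (\<forall>a \<in> E. c a \<in> C) \<and> x - (\<Sum>a \<in> E. c a * l a) \<in> J}"
    (is "is_ideal ?K")
proof -
  have "x - y \<in> ?K" if "x \<in> ?K" "y \<in> ?K" for x y
  proof -
    from that obtain c d where cd: "\<forall>a \<in> E. c a \<in> C" "\<forall>a \<in> E. d a \<in> C"
      "x - (\<Sum>a \<in> E. c a * l a) \<in> J" "y - (\<Sum>a \<in> E. d a * l a) \<in> J" "x \<in> C" "y \<in> C" by auto
    have "x - y - (\<Sum>a \<in> E. (c a - d a) * l a) =
        (x - (\<Sum>a \<in> E. c a * l a)) - (y - (\<Sum>a \<in> E. d a * l a))"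
      by (simp add: left_diff_distrib sum_subtractf)
    also have "\<dots> \<in> J" using cd by (metis ideal_diff[OF J])
    finally show ?thesis using cd
      by (intro CollectI conjI exI[of _ "\<lambda>a. c a - d a"]) (auto intro: closed)
  qed
  moreover have "z * x \<in> ?K" if "x \<in> ?K" "z \<in> C" for x z
  proof -
    from that obtain c where c: "\<forall>a \<in> E. c a \<in> C" "x - (\<Sum>a \<in> E. c a * l a) \<in> J" "x \<in> C" by auto
    have "z * x - (\<Sum>a \<in> E. (z * c a) * l a) = z * (x - (\<Sum>a \<in> E. c a * l a))"
      by (simp add: right_diff_distrib sum_distrib_left mult.assoc)
    also have "\<dots> \<in> J" using c that by (intro ideal_mult[OF J])
    finally show ?thesis using c that
      by (intro CollectI conjI exI[of _ "\<lambda>a. z * c a"]) (auto intro: closed)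
  qed
  moreover have "0 \<in> ?K"
    using J by (intro CollectI conjI exI[of _ "\<lambda>_. 0"]) (auto intro: closed ideal_zero)
  ultimately show ?thesis unfolding is_ideal_def by blast
qed

text \<open>
  Used to see that having a power in a given ideal passes from the variables to the whole irrelevant
  ideal.
\<close>

lemma is_ideal_radical:
  assumes K: "is_ideal K"
  shows "is_ideal {x \<in> C. \<exists>k. x ^ k \<in> K}" (is "is_ideal ?R")
proof -
  have high: "x ^ i \<in> K" if "x ^ k \<in> K" "k \<le> i" "x \<in> C" for x i k
    using ideal_mult[OF K power_closed[OF that(3), of "i - k"] that(1)] that(2)
    by (simp flip: power_add)
  have "x + y \<in> ?R" if "x \<in> ?R" "y \<in> ?R" for x y
  proof -
    from that obtain k m where xy: "x \<in> C" "y \<in> C" "x ^ k \<in> K" "y ^ m \<in> K" by auto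
    have of_nat: "of_nat j \<in> C" for j by (induction j) (auto intro: closed)
    have "of_nat ((k + m) choose i) * x ^ i * y ^ (k + m - i) \<in> K" if "i \<le> k + m" for i
    proof (cases "k \<le> i")
      case True
      then have "x ^ i \<in> K" using high xy by blast
      then have "(of_nat ((k + m) choose i) * y ^ (k + m - i)) * x ^ i \<in> K"
        using xy by (intro ideal_mult[OF K] closed of_nat)
      then show ?thesis by (simp add: ac_simps)
    next
      case False
      then have "m \<le> k + m - i" by simp
      then have "y ^ (k + m - i) \<in> K" using high xy by blast
      then show ?thesis using xy by (intro ideal_mult[OF K] closed of_nat)
    qed
    then have "(x + y) ^ (k + m) \<in> K"
      unfolding binomial_ring by (intro ideal_sum[OF K]) auto
    then show ?thesis using xy by (auto intro: closed)
  qed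
  moreover have mult: "z * x \<in> ?R" if "x \<in> ?R" "z \<in> C" for x z
    using that by (auto simp: power_mult_distrib intro!: closed ideal_mult[OF K] exI)
  moreover have "- x \<in> ?R" if "x \<in> ?R" for x
    using mult[OF that, of "- 1"] by (simp add: closed)
  moreover have "0 \<in> ?R"
    using ideal_zero[OF K] by (auto intro: closed exI[of _ 1])
  ultimately show ?thesis unfolding is_ideal_def
    by (metis (no_types, lifting) diff_conv_add_uminus mem_Collect_eq subsetI)
qed

end

lemma (in cring) genideal_insert:
  assumes "S \<subseteq> carrier R" "x \<in> carrier R"
  shows "Idl (insert x S) = Idl S <+> PIdl x"
proof
  have I: "ideal (Idl S) R" and P: "ideal (PIdl x) R"
    using assms genideal_ideal cgenideal_ideal by auto
  interpret I: ideal "Idl S" R by (rule I)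
  interpret P: ideal "PIdl x" R by (rule P)
  have "insert x S \<subseteq> Idl S <+> PIdl x"
  proof
    fix y assume y: "y \<in> insert x S"
    show "y \<in> Idl S <+> PIdl x"
    proof (cases "y = x")
      case True
      then have "y = \<zero> \<oplus> x" using assms by simp
      then show ?thesis
        unfolding set_add_def' using I.zero_closed cgenideal_self[OF assms(2)] by blast
    next
      case False
      then have "y \<in> Idl S" "y = y \<oplus> \<zero>" using y assms genideal_self by auto
      then show ?thesis unfolding set_add_def' using P.zero_closed by blast
    qed
  qed
  then show "Idl (insert x S) \<subseteq> Idl S <+> PIdl x"
    by (intro genideal_minimal add_ideals I P)
next
  interpret X: ideal "Idl (insert x S)" R using assms by (intro genideal_ideal) auto
  have "insert x S \<subseteq> Idl (insert x S)" using assms by (intro genideal_self) auto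
  then have "Idl S \<subseteq> Idl (insert x S)" "PIdl x \<subseteq> Idl (insert x S)"
    by (simp_all add: genideal_minimal[OF X.ideal_axioms] cgenideal_minimal[OF X.ideal_axioms])
  moreover have "Idl S <+> PIdl x \<subseteq> Idl (insert x S)"
    if sub: "Idl S \<subseteq> Idl (insert x S)" "PIdl x \<subseteq> Idl (insert x S)"
  proof
    fix y :: 'a assume "y \<in> Idl S <+> PIdl x"
    then obtain a b where "y = a \<oplus> b" "a \<in> Idl S" "b \<in> PIdl x" unfolding set_add_def' by blast
    then show "y \<in> Idl (insert x S)" using sub X.a_closed by (simp add: subset_iff)
  qed
  ultimately show "Idl S <+> PIdl x \<subseteq> Idl (insert x S)" by blast
qed

text \<open>
  A regular sequence of residue classes is traded for an increasing chain of ideals of the original ring,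
  namely the preimages of the ideals generated by its initial segments. Calculations can then be done
  with representatives instead of cosets.
\<close>

lemma (in cring) regular_seq_quotient_lift:
  assumes I: "ideal I R" and reg: "regular_seq (R Quot I) xs"
    and y: "\<And>i. i < length xs \<Longrightarrow> y i \<in> carrier R \<and> xs ! i = I +> y i"
  obtains J where "J 0 = I" "\<And>i. ideal (J i) R"
    "\<And>i. i < length xs \<Longrightarrow> J (Suc i) = J i <+> PIdl (y i)"
    "\<And>i a. i < length xs \<Longrightarrow> a \<in> carrier R \<Longrightarrow> y i \<otimes> a \<in> J i \<Longrightarrow> a \<in> J i"
proof -
  interpret I: ideal I R by (rule I)
  interpret Q: cring "R Quot I" by (rule I.quotient_is_cring) (rule is_cring)
  interpret h: ring_hom_ring R "R Quot I" "(+>) I" by (rule I.rcos_ring_hom_ring)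
  have surj: "\<exists>c \<in> carrier R. b = I +> c" if "b \<in> carrier (R Quot I)" for b
    using that unfolding FactRing_def A_RCOSETS_def'[of R I] by simp
  define A where "A i = genideal (R Quot I) (set (take i xs))" for i
  define J where "J i = {a \<in> carrier R. I +> a \<in> A i}" for i
  have xs: "set (take i xs) \<subseteq> carrier (R Quot I)" for i
    using reg set_take_subset[of i xs] by (auto simp: regular_seq_def)
  have A: "ideal (A i) (R Quot I)" for i
    unfolding A_def by (rule Q.genideal_ideal[OF xs])
  show thesis
  proof (rule that[of J])
    have "A 0 \<subseteq> {\<zero>\<^bsub>R Quot I\<^esub>}"
      unfolding A_def by (rule Q.genideal_minimal[OF Q.zeroideal]) simp
    moreover have "\<zero>\<^bsub>R Quot I\<^esub> \<in> A 0"
      by (rule additive_subgroup.zero_closed[OF ideal.axioms(1)[OF A]])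
    ultimately have "A 0 = {\<zero>\<^bsub>R Quot I\<^esub>}" by blast
    then have A0: "A 0 = {I}" by (simp only: FactRing_def ring.simps)
    show "J 0 = I"
    proof (rule subset_antisym; rule subsetI)
      fix a assume "a \<in> J 0"
      then have a: "a \<in> carrier R" "I +> a \<in> A 0" unfolding J_def by blast+
      then have "I +> a = I" unfolding A0 by blast
      then show "a \<in> I" using I.a_rcos_self[OF a(1)] by blast
    next
      fix a assume "a \<in> I"
      then show "a \<in> J 0" unfolding J_def A0 using I.a_rcos_const I.a_Hcarr by blast
    qed
    show "ideal (J i) R" for i
      unfolding J_def using h.ideal_vimage[OF A] by simp
    fix i assume i: "i < length xs"
    have "set (take (Suc i) xs) = insert (xs ! i) (set (take i xs))"
      using i by (simp add: take_Suc_conv_app_nth)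
    moreover have xi: "xs ! i \<in> carrier (R Quot I)" using y[OF i] by auto
    ultimately have ASuc: "A (Suc i) = A i <+>\<^bsub>R Quot I\<^esub> PIdl\<^bsub>R Quot I\<^esub> (xs ! i)"
      unfolding A_def using Q.genideal_insert[OF xs] by simp
    interpret Ai: ideal "A i" "R Quot I" by (rule A)
    show "J (Suc i) = J i <+> PIdl (y i)"
    proof (rule subset_antisym; rule subsetI)
      fix a :: 'a assume "a \<in> J (Suc i)"
      then have a: "a \<in> carrier R" "I +> a \<in> A (Suc i)" unfolding J_def by blast+
      then obtain u b where ub: "I +> a = u \<oplus>\<^bsub>R Quot I\<^esub> (b \<otimes>\<^bsub>R Quot I\<^esub> xs ! i)" "u \<in> A i"
        "b \<in> carrier (R Quot I)"
        unfolding ASuc set_add_def' cgenideal_def by blast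
      obtain c where c: "c \<in> carrier R" "b = I +> c" using surj[OF ub(3)] by (elim bexE)
      have cy: "c \<otimes> y i \<in> carrier R" using c(1) y[OF i] by simp
      have u: "u \<in> carrier (R Quot I)" by (rule Ai.a_Hcarr[OF ub(2)])
      let ?w = "I +> (c \<otimes> y i)"
      have w: "?w \<in> carrier (R Quot I)" by (rule h.hom_closed[OF cy])
      have "I +> a = u \<oplus>\<^bsub>R Quot I\<^esub> ?w"
        unfolding ub(1) c(2) conjunct2[OF y[OF i]] h.hom_mult[OF c(1) conjunct1[OF y[OF i]]] by (rule refl)
      then have "I +> (a \<ominus> c \<otimes> y i) = (u \<oplus>\<^bsub>R Quot I\<^esub> ?w) \<oplus>\<^bsub>R Quot I\<^esub> \<ominus>\<^bsub>R Quot I\<^esub> ?w"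
        unfolding a_minus_def h.hom_add[OF a(1) a_inv_closed[OF cy]] h.hom_a_inv[OF cy] by (rule arg_cong)
      also have "\<dots> = u"
        unfolding Q.a_assoc[OF u w Q.a_inv_closed[OF w]] Q.r_neg[OF w] by (rule Q.r_zero[OF u])
      finally have "a \<ominus> c \<otimes> y i \<in> J i"
        unfolding J_def using ub(2) minus_closed[OF a(1) cy] by blast
      moreover have "a = (a \<ominus> c \<otimes> y i) \<oplus> c \<otimes> y i"
        using a(1) cy by (simp add: a_minus_def a_assoc l_neg)
      ultimately show "a \<in> J i <+> PIdl (y i)"
        unfolding set_add_def' cgenideal_def using c(1) by blast
    next
      fix a :: 'a assume "a \<in> J i <+> PIdl (y i)"
      then obtain j c where a: "a = j \<oplus> c \<otimes> y i" "j \<in> J i" "c \<in> carrier R"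
        unfolding set_add_def' cgenideal_def by blast
      have j: "j \<in> carrier R" "I +> j \<in> A i" using a(2) unfolding J_def by blast+
      have cy: "c \<otimes> y i \<in> carrier R" using a(3) y[OF i] by simp
      have "I +> a = (I +> j) \<oplus>\<^bsub>R Quot I\<^esub> ((I +> c) \<otimes>\<^bsub>R Quot I\<^esub> xs ! i)"
        unfolding a(1) h.hom_add[OF j(1) cy] h.hom_mult[OF a(3) conjunct1[OF y[OF i]]]
          conjunct2[OF y[OF i]] by (rule refl)
      also have "\<dots> \<in> A (Suc i)"
        unfolding ASuc set_add_def' cgenideal_def using j(2) h.hom_closed[OF a(3)] by blast
      finally show "a \<in> J (Suc i)"
        unfolding J_def a(1) using a_closed[OF j(1) cy] by blast
    qed
    fix a assume a: "a \<in> carrier R" "y i \<otimes> a \<in> J i"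
    then have "I +> (y i \<otimes> a) \<in> A i" unfolding J_def by blast
    then have "xs ! i \<otimes>\<^bsub>R Quot I\<^esub> (I +> a) \<in> A i"
      unfolding h.hom_mult[OF conjunct1[OF y[OF i]] a(1)] conjunct2[OF y[OF i]] .
    then have "I +> a \<in> A i"
      using reg i h.hom_closed[OF a(1)] unfolding regular_seq_def A_def by blast
    then show "a \<in> J i" unfolding J_def using a(1) by blast
  qed
qed

lemma Sup_enat_eq_attained:
  assumes "Sup A = enat r" "r \<noteq> 0"
  shows "enat r \<in> A"
proof (rule ccontr)
  assume "enat r \<notin> A"
  have "x \<le> enat (r - 1)" if "x \<in> A" for x
  proof -
    have "x \<le> enat r" using Sup_upper[OF that] assms by simp
    moreover have "x \<noteq> enat r" using that \<open>enat r \<notin> A\<close> by blast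
    ultimately show ?thesis by (cases x) auto
  qed
  then have "Sup A \<le> enat (r - 1)" by (rule Sup_least)
  then show False using assms by simp
qed

section \<open>The Koszul complex\<close>

text \<open>
  A chain of homological degree \<open>q\<close> in the Koszul complex of a family \<open>l\<close> indexed by \<open>E\<close> is given by its
  coefficients at the subsets of \<open>E\<close> of size \<open>q\<close>. The sign is that of moving the basis vector \<open>a\<close> past the
  smaller basis vectors in the exterior product over \<open>S\<close>.
\<close>

definition koszul_sign :: "nat \<Rightarrow> nat set \<Rightarrow> 'a::comm_ring_1" where
  "koszul_sign a S = (- 1) ^ card {b \<in> S. b < a}"

definition koszul_diff :: "nat set \<Rightarrow> (nat \<Rightarrow> 'a::comm_ring_1) \<Rightarrow> (nat set \<Rightarrow> 'a) \<Rightarrow> nat set \<Rightarrow> 'a" where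
  "koszul_diff E l h S = (\<Sum>a \<in> E - S. koszul_sign a S * l a * h (insert a S))"

text \<open>
  Exterior multiplication by the vector with coordinates \<open>c\<close>.
\<close>

definition koszul_homotopy :: "(nat \<Rightarrow> 'a::comm_ring_1) \<Rightarrow> (nat set \<Rightarrow> 'a) \<Rightarrow> nat set \<Rightarrow> 'a" where
  "koszul_homotopy c h S = (\<Sum>a \<in> S. koszul_sign a S * c a * h (S - {a}))"

lemma koszul_sign_square: "koszul_sign a S * koszul_sign a S = 1"
  by (simp add: koszul_sign_def flip: power_add mult_2)

lemma koszul_sign_insert_self [simp]: "koszul_sign a (insert a S) = koszul_sign a S"
proof -
  have "{b \<in> insert a S. b < a} = {b \<in> S. b < a}" by auto
  then show ?thesis by (simp add: koszul_sign_def)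
qed

lemma koszul_sign_insert:
  assumes "finite S" "a \<notin> S"
  shows "koszul_sign b (insert a S) = (if a < b then - koszul_sign b S else koszul_sign b S)"
proof (cases "a < b")
  case True
  then have "{x \<in> insert a S. x < b} = insert a {x \<in> S. x < b}" by auto
  then show ?thesis using assms True by (simp add: koszul_sign_def)
next
  case False
  then have "{x \<in> insert a S. x < b} = {x \<in> S. x < b}" by auto
  then show ?thesis using False by (simp add: koszul_sign_def)
qed

lemma koszul_sign_exchange:
  assumes "finite S" "a \<notin> S" "b \<notin> S" "a \<noteq> b"
  shows "koszul_sign a S * koszul_sign b (insert a S) = - (koszul_sign b S * koszul_sign a (insert b S))"
  using assms by (auto simp: koszul_sign_insert)

lemma koszul_sign_remove:
  assumes "finite S" "a \<notin> S" "b \<in> S"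
  shows "koszul_sign a S * koszul_sign b (insert a S) = - (koszul_sign b S * koszul_sign a (S - {b}))"
proof -
  obtain T where T: "S = insert b T" "b \<notin> T" using assms(3) by (meson mk_disjoint_insert)
  have "koszul_sign b (insert a S) = (koszul_sign b (insert a T) :: 'a)"
    unfolding T(1) insert_commute[of a b T] by (rule koszul_sign_insert_self)
  moreover have "S - {b} = T" using T by auto
  moreover have "finite T" "a \<notin> T" "a \<noteq> b" using T assms by auto
  ultimately show ?thesis using T by (auto simp: koszul_sign_insert)
qed

text \<open>
  Cancelling the terms in pairs avoids a division by two, so that this holds in any abelian group.
\<close>

lemma sum_antisymmetric:
  fixes U :: "'b \<Rightarrow> 'b \<Rightarrow> 'a::ab_group_add"
  assumes "finite A" "\<And>a b. a \<in> A \<Longrightarrow> b \<in> A \<Longrightarrow> a \<noteq> b \<Longrightarrow> U a b = - U b a"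
  shows "(\<Sum>a \<in> A. \<Sum>b \<in> A - {a}. U a b) = 0"
  using assms
proof (induction A)
  case (insert x A)
  have "(\<Sum>b \<in> insert x A - {a}. U a b) = U a x + (\<Sum>b \<in> A - {a}. U a b)" if "a \<in> A" for a
  proof -
    have "insert x A - {a} = insert x (A - {a})" using that insert.hyps by auto
    then show ?thesis using insert.hyps by simp
  qed
  moreover have "insert x A - {x} = A" using insert.hyps by auto
  ultimately have "(\<Sum>a \<in> insert x A. \<Sum>b \<in> insert x A - {a}. U a b) =
      (\<Sum>b \<in> A. U x b) + ((\<Sum>a \<in> A. U a x) + (\<Sum>a \<in> A. \<Sum>b \<in> A - {a}. U a b))"
    using insert.hyps by (simp add: sum.distrib)
  also have "(\<Sum>a \<in> A. \<Sum>b \<in> A - {a}. U a b) = 0" using insert by blast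
  also have "(\<Sum>b \<in> A. U x b) = - (\<Sum>a \<in> A. U a x)"
    unfolding sum_negf[symmetric] using insert.hyps by (intro sum.cong refl insert.prems) auto
  finally show ?case by simp
qed simp

lemma koszul_diff_diff:
  assumes "finite E" "S \<subseteq> E"
  shows "koszul_diff E l (koszul_diff E l h) S = 0"
proof -
  define U where "U a b = koszul_sign a S * koszul_sign b (insert a S) * (l a * l b * h (insert a (insert b S)))"
    for a b
  have fin: "finite S" using assms finite_subset by blast
  have "koszul_diff E l (koszul_diff E l h) S = (\<Sum>a \<in> E - S. \<Sum>b \<in> (E - S) - {a}. U a b)"
    unfolding koszul_diff_def
  proof (intro sum.cong refl)
    fix a assume a: "a \<in> E - S"
    have "E - insert a S = (E - S) - {a}" by auto
    then show "koszul_sign a S * l a * (\<Sum>b \<in> E - insert a S. koszul_sign b (insert a S) * l b *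
        h (insert b (insert a S))) = (\<Sum>b \<in> (E - S) - {a}. U a b)"
      by (simp add: sum_distrib_left U_def insert_commute algebra_simps)
  qed
  also have "\<dots> = 0"
  proof (rule sum_antisymmetric)
    fix a b assume "a \<in> E - S" "b \<in> E - S" "a \<noteq> b"
    then show "U a b = - U b a"
      unfolding U_def using koszul_sign_exchange[OF fin, of a b, where 'a='a]
      by (simp add: insert_commute mult.commute[of "l a"])
  qed (use assms in auto)
  finally show ?thesis .
qed

text \<open>
  Contraction with \<open>l\<close> and exterior multiplication by \<open>c\<close> anticommute up to the scalar \<open>\<Sum> c\<^sub>a l\<^sub>a\<close>: the
  terms in which the same index is inserted and removed add up to this scalar, and the others cancel
  by the sign rule. Consequently every element of the ideal generated by the \<open>l\<^sub>a\<close> annihilates Koszul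
  homology.
\<close>

lemma koszul_homotopy:
  assumes "finite E" "S \<subseteq> E"
  shows "koszul_diff E l (koszul_homotopy c h) S =
    (\<Sum>a \<in> E. c a * l a) * h S - koszul_homotopy c (koszul_diff E l h) S"
proof -
  have fin: "finite S" using assms finite_subset by blast
  define T where "T a b = koszul_sign a S * koszul_sign b (insert a S) *
    (l a * c b * h (insert a (S - {b})))" for a b
  have "koszul_diff E l (koszul_homotopy c h) S =
      (\<Sum>a \<in> E - S. c a * l a * h S + (\<Sum>b \<in> S. T a b))"
    unfolding koszul_diff_def koszul_homotopy_def
  proof (intro sum.cong refl)
    fix a assume a: "a \<in> E - S"
    have "h (insert a S - {b}) = h (insert a (S - {b}))" if "b \<in> S" for b
      using that a by (metis DiffD2 insert_Diff_if singletonD)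
    then have "koszul_sign a S * l a *
        (\<Sum>b \<in> S. koszul_sign b (insert a S) * c b * h (insert a S - {b})) = (\<Sum>b \<in> S. T a b)"
      unfolding sum_distrib_left T_def by (intro sum.cong) (auto simp: algebra_simps)
    moreover have "insert a S - {a} = S" using a by auto
    moreover have "koszul_sign a S * l a * (koszul_sign a S * c a * h S) = 
        (koszul_sign a S * koszul_sign a S) * (c a * l a * h S)" by (simp add: algebra_simps)
    ultimately show "koszul_sign a S * l a *
        (\<Sum>b \<in> insert a S. koszul_sign b (insert a S) * c b * h (insert a S - {b})) =
        c a * l a * h S + (\<Sum>b \<in> S. T a b)"
      using a fin by (simp add: distrib_left koszul_sign_square)
  qed
  also have "\<dots> = (\<Sum>a \<in> E - S. c a * l a * h S) + (\<Sum>b \<in> S. \<Sum>a \<in> E - S. T a b)"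
    using sum.swap by (auto simp: sum.distrib)
  finally have 1: "koszul_diff E l (koszul_homotopy c h) S =
      (\<Sum>a \<in> E - S. c a * l a * h S) + (\<Sum>b \<in> S. \<Sum>a \<in> E - S. T a b)" .
  have "koszul_homotopy c (koszul_diff E l h) S =
      (\<Sum>b \<in> S. c b * l b * h S - (\<Sum>a \<in> E - S. T a b))"
    unfolding koszul_diff_def koszul_homotopy_def
  proof (intro sum.cong refl)
    fix b assume b: "b \<in> S"
    have E: "E - (S - {b}) = insert b (E - S)" using b assms by auto
    have "koszul_sign b S * c b *
        (\<Sum>a \<in> E - S. koszul_sign a (S - {b}) * l a * h (insert a (S - {b}))) = - (\<Sum>a \<in> E - S. T a b)"
      unfolding sum_distrib_left sum_negf[symmetric]
    proof (intro sum.cong refl)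
      fix a assume "a \<in> E - S"
      then have "koszul_sign a S * koszul_sign b (insert a S) =
          - (koszul_sign b S * koszul_sign a (S - {b}) :: 'a)"
        using fin b by (intro koszul_sign_remove) auto
      then show "koszul_sign b S * c b * (koszul_sign a (S - {b}) * l a * h (insert a (S - {b}))) = - T a b"
        unfolding T_def by (simp add: algebra_simps)
    qed
    moreover have "koszul_sign b (S - {b}) = (koszul_sign b S :: 'a)"
      using b koszul_sign_insert_self[of b "S - {b}", where 'a='a] by (simp add: insert_absorb del: koszul_sign_insert_self)
    moreover have "koszul_sign b S * c b * (koszul_sign b S * l b * h S) =
        (koszul_sign b S * koszul_sign b S) * (c b * l b * h S)" by (simp add: algebra_simps)
    ultimately show "koszul_sign b S * c b * (\<Sum>a \<in> E - (S - {b}). koszul_sign a (S - {b}) * l a *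
        h (insert a (S - {b}))) = c b * l b * h S - (\<Sum>a \<in> E - S. T a b)"
      unfolding E using b assms by (simp add: distrib_left koszul_sign_square insert_absorb)
  qed
  then have 2: "koszul_homotopy c (koszul_diff E l h) S =
      (\<Sum>b \<in> S. c b * l b * h S) - (\<Sum>b \<in> S. \<Sum>a \<in> E - S. T a b)"
    by (simp add: sum_subtractf)
  have "(\<Sum>a \<in> E. c a * l a) * h S = (\<Sum>a \<in> E - S. c a * l a * h S) + (\<Sum>a \<in> S. c a * l a * h S)"
    using sum.subset_diff[OF assms(2,1)] by (simp add: sum_distrib_right)
  then show ?thesis unfolding 1 2 by simp
qed

context ring_subset
begin

lemma koszul_sign_closed: "koszul_sign a S \<in> C"
  by (simp add: koszul_sign_def power_closed uminus_closed one_closed)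

lemma koszul_diff_in_ideal:
  assumes "is_ideal J" "l ` E \<subseteq> C" "\<And>a. a \<in> E - S \<Longrightarrow> h (insert a S) \<in> J"
  shows "koszul_diff E l h S \<in> J"
  unfolding koszul_diff_def using assms by (intro ideal_sum) (auto simp: ideal_closed closed koszul_sign_closed image_subset_iff)

text \<open>
  Vanishing of the Koszul homology of \<open>l\<close> with coefficients in \<open>C / J\<close> in homological degree \<open>q + 1\<close>.
  Chains over \<open>C / J\<close> are represented by chains over \<open>C\<close>, and only their values on subsets of the relevant
  size are constrained.
\<close>

definition koszul_exact :: "nat set \<Rightarrow> (nat \<Rightarrow> 'a) \<Rightarrow> 'a set \<Rightarrow> nat \<Rightarrow> bool" where
  "koszul_exact E l J q \<longleftrightarrow>
     (\<forall>h. (\<forall>S \<subseteq> E. card S = Suc q \<longrightarrow> h S \<in> C) \<longrightarrow>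
          (\<forall>S \<subseteq> E. card S = q \<longrightarrow> koszul_diff E l h S \<in> J) \<longrightarrow>
          (\<exists>g. (\<forall>S \<subseteq> E. card S = Suc (Suc q) \<longrightarrow> g S \<in> C) \<and>
               (\<forall>S \<subseteq> E. card S = Suc q \<longrightarrow> h S - koszul_diff E l g S \<in> J)))"

lemma koszul_exactD:
  assumes "koszul_exact E l J q"
    and "\<And>S. S \<subseteq> E \<Longrightarrow> card S = Suc q \<Longrightarrow> h S \<in> C"
    and "\<And>S. S \<subseteq> E \<Longrightarrow> card S = q \<Longrightarrow> koszul_diff E l h S \<in> J"
  obtains g where "\<And>S. S \<subseteq> E \<Longrightarrow> card S = Suc (Suc q) \<Longrightarrow> g S \<in> C"
    and "\<And>S. S \<subseteq> E \<Longrightarrow> card S = Suc q \<Longrightarrow> h S - koszul_diff E l g S \<in> J"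
proof -
  have "\<exists>g. (\<forall>S \<subseteq> E. card S = Suc (Suc q) \<longrightarrow> g S \<in> C) \<and>
      (\<forall>S \<subseteq> E. card S = Suc q \<longrightarrow> h S - koszul_diff E l g S \<in> J)"
    by (rule assms(1)[unfolded koszul_exact_def, rule_format]) (use assms(2,3) in simp_all)
  with that show thesis by blast
qed

lemma koszul_diff_add:
  "koszul_diff E l (\<lambda>S. h S + g S) S = koszul_diff E l h S + koszul_diff E l g S"
  by (simp add: koszul_diff_def distrib_left sum.distrib)

lemma koszul_diff_minus:
  "koszul_diff E l (\<lambda>S. h S - g S) S = koszul_diff E l h S - koszul_diff E l g S"
  by (simp add: koszul_diff_def right_diff_distrib sum_subtractf)

lemma koszul_diff_scale: "koszul_diff E l (\<lambda>S. y * h S) S = y * koszul_diff E l h S"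
  by (simp add: koszul_diff_def sum_distrib_left mult.left_commute)

lemma card_insert_level:
  assumes "finite E" "S \<subseteq> E" "a \<in> E - S"
  shows "insert a S \<subseteq> E" "card (insert a S) = Suc (card S)"
  using assms finite_subset[OF assms(2,1)] by auto

text \<open>
  The induction step in the proof that depth forces Koszul homology to vanish. As \<open>y\<close> lies in the ideal
  generated by \<open>l\<close> and \<open>J\<close>, it kills homology over \<open>C / J\<close>; and as it is a nonzerodivisor, the long exact
  sequence then makes the homology over \<open>C / J\<close> in degree \<open>q + 1\<close> a quotient of the homology over
  \<open>C / (J + (y))\<close> in degree \<open>q + 2\<close>. Concretely, for a cycle \<open>h\<close> the chain \<open>g\<close> obtained from the
  homotopy has boundary \<open>y h\<close>, so it is a cycle modulo \<open>y\<close>; writing it as a boundary plus \<open>y v\<close> and applying the differential gives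
  \<open>y h = y \<partial> v\<close>.
\<close>

lemma koszul_exact_step:
  assumes E: "finite E" and l: "l ` E \<subseteq> C" and J: "is_ideal J"
    and y: "y \<in> C" and nzd: "\<And>a. a \<in> C \<Longrightarrow> y * a \<in> J \<Longrightarrow> a \<in> J"
    and c: "\<And>a. a \<in> E \<Longrightarrow> c a \<in> C" and yc: "y - (\<Sum>a \<in> E. c a * l a) \<in> J"
    and ex: "koszul_exact E l (adjoin J y) (Suc q)"
  shows "koszul_exact E l J q"
  unfolding koszul_exact_def
proof (intro allI impI)
  fix h assume hC: "\<forall>S \<subseteq> E. card S = Suc q \<longrightarrow> h S \<in> C"
    and dh: "\<forall>S \<subseteq> E. card S = q \<longrightarrow> koszul_diff E l h S \<in> J"
  define g where "g = koszul_homotopy c h"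
  have fin: "finite S" if "S \<subseteq> E" for S using that E finite_subset by blast
  have gC: "g S \<in> C" if S: "S \<subseteq> E" "card S = Suc (Suc q)" for S
    unfolding g_def koszul_homotopy_def
  proof (rule sum_closed)
    fix a assume a: "a \<in> S"
    then have "S - {a} \<subseteq> E" "card (S - {a}) = Suc q" using S fin[OF S(1)] by auto
    then have "h (S - {a}) \<in> C" using hC by blast
    then show "koszul_sign a S * c a * h (S - {a}) \<in> C" using c a S by (auto intro!: closed koszul_sign_closed)
  qed
  have dg: "koszul_diff E l g S - y * h S \<in> J" if S: "S \<subseteq> E" "card S = Suc q" for S
  proof -
    have "koszul_homotopy c (koszul_diff E l h) S \<in> J"
      unfolding koszul_homotopy_def
    proof (rule ideal_sum[OF J])
      fix a assume a: "a \<in> S"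
      then have "S - {a} \<subseteq> E" "card (S - {a}) = q" using S fin[OF S(1)] by auto
      then have "koszul_diff E l h (S - {a}) \<in> J" using dh by blast
      then show "koszul_sign a S * c a * koszul_diff E l h (S - {a}) \<in> J"
        using c a S J by (auto intro!: closed koszul_sign_closed ideal_mult)
    qed
    moreover have "(y - (\<Sum>a \<in> E. c a * l a)) * h S \<in> J"
      using hC S J yc by (subst mult.commute) (auto intro: ideal_mult)
    ultimately have "- ((y - (\<Sum>a \<in> E. c a * l a)) * h S) - koszul_homotopy c (koszul_diff E l h) S \<in> J"
      using J by (intro ideal_diff ideal_uminus)
    then show ?thesis
      unfolding g_def koszul_homotopy[OF E S(1)] by (simp add: algebra_simps)
  qed
  have dg': "koszul_diff E l g S \<in> adjoin J y" if S: "S \<subseteq> E" "card S = Suc q" for S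
    using dg[OF S] hC S unfolding adjoin_def
    by (intro CollectI exI[of _ "koszul_diff E l g S - y * h S"] exI[of _ "h S"]) auto
  obtain g' where g'C: "\<And>S. S \<subseteq> E \<Longrightarrow> card S = Suc (Suc (Suc q)) \<Longrightarrow> g' S \<in> C"
    and g': "\<And>S. S \<subseteq> E \<Longrightarrow> card S = Suc (Suc q) \<Longrightarrow> g S - koszul_diff E l g' S \<in> adjoin J y"
    by (rule koszul_exactD[OF ex gC dg']) blast+
  have "\<exists>v. v \<in> C \<and> g S - koszul_diff E l g' S - y * v \<in> J"
    if "S \<subseteq> E" "card S = Suc (Suc q)" for S
    using g'[OF that] unfolding adjoin_def by fastforce
  then obtain v where vC: "\<And>S. S \<subseteq> E \<Longrightarrow> card S = Suc (Suc q) \<Longrightarrow> v S \<in> C"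
    and v: "\<And>S. S \<subseteq> E \<Longrightarrow> card S = Suc (Suc q) \<Longrightarrow> g S - koszul_diff E l g' S - y * v S \<in> J"
    by metis
  have "h S - koszul_diff E l v S \<in> J" if S: "S \<subseteq> E" "card S = Suc q" for S
  proof -
    have "koszul_diff E l (\<lambda>S. g S - koszul_diff E l g' S - y * v S) S \<in> J"
      by (rule koszul_diff_in_ideal[OF J l], rule v) (use card_insert_level[OF E S(1)] S(2) in auto)
    then have "koszul_diff E l g S - y * koszul_diff E l v S \<in> J"
      by (simp add: koszul_diff_minus koszul_diff_scale koszul_diff_diff[OF E S(1)])
    from ideal_diff[OF J this dg[OF S]] have "y * (h S - koszul_diff E l v S) \<in> J"
      by (simp add: algebra_simps)
    moreover have "h S - koszul_diff E l v S \<in> C"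
      by (rule diff_closed, use hC S in blast, rule koszul_diff_in_ideal[OF is_ideal_carrier l], rule vC)
        (use card_insert_level[OF E S(1)] S(2) in auto)
    ultimately show ?thesis using nzd by blast
  qed
  with vC show "\<exists>g. (\<forall>S \<subseteq> E. card S = Suc (Suc q) \<longrightarrow> g S \<in> C) \<and>
      (\<forall>S \<subseteq> E. card S = Suc q \<longrightarrow> h S - koszul_diff E l g S \<in> J)" by blast
qed

text \<open>
  The quotient \<open>C / (J + (y\<^sup>k))\<close> has a filtration with all factors isomorphic to \<open>C / (J + (y))\<close>, because
  \<open>y\<close> is a nonzerodivisor modulo \<open>J\<close>. Vanishing of homology therefore passes from \<open>y\<close> to its powers. This
  is needed because in general only a power of a member of the regular sequence lies in the
  ideal generated by \<open>l\<close> and \<open>J\<close>.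
\<close>

lemma koszul_exact_power:
  assumes E: "finite E" and l: "l ` E \<subseteq> C" and J: "is_ideal J"
    and y: "y \<in> C" and nzd: "\<And>a. a \<in> C \<Longrightarrow> y * a \<in> J \<Longrightarrow> a \<in> J"
    and ex: "koszul_exact E l (adjoin J y) q"
  shows "koszul_exact E l (adjoin J (y ^ k)) q"
proof (induction k)
  case 0
  have "adjoin J (y ^ 0) = C"
    using J unfolding adjoin_def by (force intro: closed ideal_subset ideal_zero)
  then show ?case
    unfolding koszul_exact_def by (auto intro!: exI[of _ "\<lambda>_. 0"] simp: closed koszul_diff_def)
next
  case (Suc k)
  show ?case unfolding koszul_exact_def
  proof (intro allI impI)
    fix h assume hC: "\<forall>S \<subseteq> E. card S = Suc q \<longrightarrow> h S \<in> C"
      and dh: "\<forall>S \<subseteq> E. card S = q \<longrightarrow> koszul_diff E l h S \<in> adjoin J (y ^ Suc k)"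
    have sub: "adjoin J (y ^ Suc k) \<subseteq> adjoin J y"
    proof
      fix x assume "x \<in> adjoin J (y ^ Suc k)"
      then obtain j c where "x = j + y * (y ^ k * c)" "j \<in> J" "c \<in> C"
        by (auto simp: adjoin_def mult.assoc)
      moreover from this y have "y ^ k * c \<in> C" by (auto intro!: closed)
      ultimately show "x \<in> adjoin J y" by (auto simp: adjoin_def)
    qed
    have dh': "koszul_diff E l h S \<in> adjoin J y" if "S \<subseteq> E" "card S = q" for S
      using dh sub that by blast
    obtain g where gC: "\<And>S. S \<subseteq> E \<Longrightarrow> card S = Suc (Suc q) \<Longrightarrow> g S \<in> C"
      and g: "\<And>S. S \<subseteq> E \<Longrightarrow> card S = Suc q \<Longrightarrow> h S - koszul_diff E l g S \<in> adjoin J y"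
      by (rule koszul_exactD[OF ex hC[rule_format] dh']) blast+
    have "\<exists>v. v \<in> C \<and> h S - koszul_diff E l g S - y * v \<in> J" if "S \<subseteq> E" "card S = Suc q" for S
      using g[OF that] unfolding adjoin_def by fastforce
    then obtain v where vC: "\<And>S. S \<subseteq> E \<Longrightarrow> card S = Suc q \<Longrightarrow> v S \<in> C"
      and v: "\<And>S. S \<subseteq> E \<Longrightarrow> card S = Suc q \<Longrightarrow> h S - koszul_diff E l g S - y * v S \<in> J"
      by metis
    have dv: "koszul_diff E l v S \<in> adjoin J (y ^ k)" if S: "S \<subseteq> E" "card S = q" for S
    proof -
      have "koszul_diff E l (\<lambda>S. h S - koszul_diff E l g S - y * v S) S \<in> J"
        by (rule koszul_diff_in_ideal[OF J l], rule v) (use card_insert_level[OF E S(1)] S(2) in auto)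
      then have 1: "koszul_diff E l h S - y * koszul_diff E l v S \<in> J"
        by (simp add: koszul_diff_minus koszul_diff_scale koszul_diff_diff[OF E S(1)])
      from dh S obtain j c where jc: "koszul_diff E l h S = j + y ^ Suc k * c" "j \<in> J" "c \<in> C"
        by (auto simp: adjoin_def)
      from ideal_diff[OF J jc(2) 1] have "y * (koszul_diff E l v S - y ^ k * c) \<in> J"
        unfolding jc(1) by (simp add: algebra_simps)
      moreover have "koszul_diff E l v S - y ^ k * c \<in> C"
        by (rule diff_closed, rule koszul_diff_in_ideal[OF is_ideal_carrier l], rule vC)
          (use card_insert_level[OF E S(1)] S(2) y jc(3) in \<open>auto intro!: closed\<close>)
      ultimately have "koszul_diff E l v S - y ^ k * c \<in> J" using nzd by blast
      then show ?thesis using jc(3) unfolding adjoin_def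
        by (intro CollectI exI[of _ "koszul_diff E l v S - y ^ k * c"] exI[of _ c]) auto
    qed
    obtain g' where g'C: "\<And>S. S \<subseteq> E \<Longrightarrow> card S = Suc (Suc q) \<Longrightarrow> g' S \<in> C"
      and g': "\<And>S. S \<subseteq> E \<Longrightarrow> card S = Suc q \<Longrightarrow> v S - koszul_diff E l g' S \<in> adjoin J (y ^ k)"
      by (rule koszul_exactD[OF Suc.IH vC dv]) blast+
    have "h S - koszul_diff E l (\<lambda>S. g S + y * g' S) S \<in> adjoin J (y ^ Suc k)"
      if S: "S \<subseteq> E" "card S = Suc q" for S
    proof -
      from g'[OF S] obtain j c where jc: "v S - koszul_diff E l g' S = j + y ^ k * c" "j \<in> J" "c \<in> C"
        by (auto simp: adjoin_def)
      have "h S - koszul_diff E l (\<lambda>S. g S + y * g' S) S =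
          (h S - koszul_diff E l g S - y * v S) + y * (v S - koszul_diff E l g' S)"
        by (simp add: koszul_diff_add koszul_diff_scale algebra_simps)
      also have "\<dots> = ((h S - koszul_diff E l g S - y * v S) + y * j) + y ^ Suc k * c"
        unfolding jc(1) by (simp add: algebra_simps)
      finally have "h S - koszul_diff E l (\<lambda>S. g S + y * g' S) S =
          ((h S - koszul_diff E l g S - y * v S) + y * j) + y ^ Suc k * c" .
      moreover have "(h S - koszul_diff E l g S - y * v S) + y * j \<in> J"
        using v[OF S] jc y J by (intro ideal_add ideal_mult)
      ultimately show ?thesis
        unfolding adjoin_def using jc(3) by blast
    qed
    moreover have "g S + y * g' S \<in> C" if "S \<subseteq> E" "card S = Suc (Suc q)" for S
      using that gC g'C y by (auto intro!: closed)
    ultimately show "\<exists>g. (\<forall>S \<subseteq> E. card S = Suc (Suc q) \<longrightarrow> g S \<in> C) \<and>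
      (\<forall>S \<subseteq> E. card S = Suc q \<longrightarrow> h S - koszul_diff E l g S \<in> adjoin J (y ^ Suc k))"
      by (intro exI[of _ "\<lambda>S. g S + y * g' S"]) blast
  qed
qed

text \<open>
  Descending induction on \<open>i\<close> shows that the homology over \<open>C / J i\<close> vanishes in degree \<open>i + 1\<close>. It starts at
  \<open>i = card E\<close>, where no subset of \<open>E\<close> has the required size.
\<close>

theorem regular_sequence_koszul_exact:
  assumes E: "finite E" and l: "l ` E \<subseteq> C"
    and J: "\<And>i. i \<le> card E \<Longrightarrow> is_ideal (J i)"
    and y: "\<And>i. i < card E \<Longrightarrow> y i \<in> C"
    and J_Suc: "\<And>i. i < card E \<Longrightarrow> J (Suc i) = adjoin (J i) (y i)"
    and nzd: "\<And>i a. i < card E \<Longrightarrow> a \<in> C \<Longrightarrow> y i * a \<in> J i \<Longrightarrow> a \<in> J i"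
    and rad: "\<And>i. i < card E \<Longrightarrow>
      \<exists>k c. (\<forall>a \<in> E. c a \<in> C) \<and> y i ^ k - (\<Sum>a \<in> E. c a * l a) \<in> J 0"
  shows "koszul_exact E l (J 0) 0"
proof -
  have mono: "J 0 \<subseteq> J i" if "i \<le> card E" for i
    using that
  proof (induction i)
    case (Suc i)
    have "J i \<subseteq> adjoin (J i) (y i)"
      unfolding adjoin_def using zero_closed by force
    then show ?case using Suc J_Suc[of i] by auto
  qed simp
  have "koszul_exact E l (J i) i" if "i \<le> card E" for i
    using that
  proof (induction rule: inc_induct)
    case base
    have False if "S \<subseteq> E" "card S = Suc (card E)" for S
      using that E card_mono by (metis Suc_n_not_le_n)
    then show ?case
      unfolding koszul_exact_def by (intro allI impI exI[of _ "\<lambda>_. 0"]) (use zero_closed in blast)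
  next
    case (step i)
    obtain k c where c: "\<And>a. a \<in> E \<Longrightarrow> c a \<in> C" "y i ^ k - (\<Sum>a \<in> E. c a * l a) \<in> J 0"
      using rad step.hyps by blast
    have Ji: "is_ideal (J i)" and yi: "y i \<in> C" using J y step.hyps by auto
    have nzdk: "a \<in> J i" if "a \<in> C" "y i ^ k * a \<in> J i" for a
      using that
    proof (induction k)
      case (Suc k)
      have "y i * (y i ^ k * a) \<in> J i" using Suc.prems by (simp add: mult.assoc)
      moreover have "y i ^ k * a \<in> C" using Suc.prems yi by (auto intro!: closed)
      ultimately have "y i ^ k * a \<in> J i" using nzd[OF step.hyps(2)] by blast
      then show ?case using Suc by blast
    qed simp
    have "koszul_exact E l (adjoin (J i) (y i ^ k)) (Suc i)"
      by (rule koszul_exact_power[OF E l Ji yi])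
        (use step J_Suc[of i] nzd[of i] in \<open>auto simp: Suc_le_eq\<close>)
    then show ?case
      by (rule koszul_exact_step[OF E l Ji power_closed[OF yi] nzdk c(1), rotated -1])
        (use c(2) mono[of i] step.hyps in auto)
  qed
  then show ?thesis by blast
qed

end

section \<open>Evaluation and multigrading of polynomials\<close>

lemma poly_mapping_eq_sum_single: "F = (\<Sum>m \<in> Poly_Mapping.keys F. Poly_Mapping.single m (Poly_Mapping.lookup F m))"
  by (rule poly_mapping_eqI)
    (simp add: lookup_sum lookup_single when_def not_in_keys_iff_lookup_eq_zero)

definition monomial_value :: "(mvar \<Rightarrow> 'k::comm_ring_1) \<Rightarrow> (mvar \<Rightarrow>\<^sub>0 nat) \<Rightarrow> 'k" where
  "monomial_value a m = (\<Prod>x \<in> Poly_Mapping.keys m. a x ^ Poly_Mapping.lookup m x)"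

lemma monomial_value_superset:
  assumes "finite A" "Poly_Mapping.keys m \<subseteq> A"
  shows "monomial_value a m = (\<Prod>x \<in> A. a x ^ Poly_Mapping.lookup m x)"
  unfolding monomial_value_def
  by (rule prod.mono_neutral_left) (use assms in \<open>auto simp: in_keys_iff\<close>)

lemma monomial_value_add: "monomial_value a (m + m') = monomial_value a m * monomial_value a m'"
proof -
  let ?A = "Poly_Mapping.keys m \<union> Poly_Mapping.keys m'"
  have "monomial_value a (m + m') = (\<Prod>x \<in> ?A. a x ^ Poly_Mapping.lookup (m + m') x)"
    using Poly_Mapping.keys_add[of m m'] by (intro monomial_value_superset) auto
  also have "\<dots> = (\<Prod>x \<in> ?A. a x ^ Poly_Mapping.lookup m x) * (\<Prod>x \<in> ?A. a x ^ Poly_Mapping.lookup m' x)"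
    by (simp add: lookup_add power_add prod.distrib)
  finally show ?thesis by (simp add: monomial_value_superset[of ?A])
qed

lemma mp_eval_superset:
  assumes "finite A" "Poly_Mapping.keys F \<subseteq> A"
  shows "mp_eval a F = (\<Sum>m \<in> A. Poly_Mapping.lookup F m * monomial_value a m)"
  unfolding mp_eval_def monomial_value_def
  by (rule sum.mono_neutral_left) (use assms in \<open>auto simp: in_keys_iff\<close>)

lemma mp_eval_single [simp]: "mp_eval a (Poly_Mapping.single m c) = c * monomial_value a m"
  by (subst mp_eval_superset[of "{m}"]) auto

lemma mp_eval_zero [simp]: "mp_eval a 0 = 0"
  by (simp add: mp_eval_def)

lemma mp_eval_add [simp]: "mp_eval a (F + G) = mp_eval a F + mp_eval a G"
proof -
  let ?A = "Poly_Mapping.keys F \<union> Poly_Mapping.keys G"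
  have "mp_eval a (F + G) = (\<Sum>m \<in> ?A. Poly_Mapping.lookup (F + G) m * monomial_value a m)"
    using Poly_Mapping.keys_add[of F G] by (intro mp_eval_superset) auto
  then show ?thesis
    by (simp add: lookup_add distrib_right sum.distrib mp_eval_superset[of ?A])
qed

lemma mp_eval_sum: "mp_eval a (\<Sum>x \<in> A. f x) = (\<Sum>x \<in> A. mp_eval a (f x))"
  by (induction A rule: infinite_finite_induct) auto

lemma mp_eval_uminus [simp]: "mp_eval a (- F) = - mp_eval a F"
  using mp_eval_add[of a F "- F"] by (simp add: eq_neg_iff_add_eq_0 add.commute)

lemma mp_eval_diff [simp]: "mp_eval a (F - G) = mp_eval a F - mp_eval a G"
  using mp_eval_add[of a F "- G"] by simp

lemma mp_eval_mult [simp]: "mp_eval a (F * G) = mp_eval a F * mp_eval a G"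
proof -
  have "mp_eval a (F * G) = (\<Sum>m \<in> Poly_Mapping.keys F. \<Sum>m' \<in> Poly_Mapping.keys G.
      Poly_Mapping.lookup F m * Poly_Mapping.lookup G m' * monomial_value a (m + m'))"
    by (subst poly_mapping_eq_sum_single[of F], subst poly_mapping_eq_sum_single[of G])
      (simp add: sum_product mp_eval_sum mult_single)
  also have "\<dots> = mp_eval a F * mp_eval a G"
    unfolding mp_eval_superset[of _ F, OF finite_keys order_refl]
      mp_eval_superset[of _ G, OF finite_keys order_refl] sum_product
    by (simp add: monomial_value_add algebra_simps)
  finally show ?thesis .
qed

lemma mp_eval_one [simp]: "mp_eval a 1 = 1"
  using mp_eval_single[of a 0 1] by (simp add: monomial_value_def)

lemma mp_eval_power [simp]: "mp_eval a (F ^ k) = mp_eval a F ^ k"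
  by (induction k) auto

lemma mp_eval_prod: "mp_eval a (\<Prod>x \<in> A. f x) = (\<Prod>x \<in> A. mp_eval a (f x))"
  by (induction A rule: infinite_finite_induct) auto

lemma mp_eval_mvar [simp]: "mp_eval a (mvar x) = a x"
  by (simp add: mvar_def monomial_value_def)

lemma mdeg_superset:
  assumes "finite A" "Poly_Mapping.keys m \<subseteq> A"
  shows "mdeg m i = (\<Sum>x | x \<in> A \<and> fst x = i. Poly_Mapping.lookup m x)"
  unfolding mdeg_def
  by (rule sum.mono_neutral_left) (use assms in \<open>auto simp: in_keys_iff\<close>)

lemma mdeg_add: "mdeg (m + m') = (\<lambda>i. mdeg m i + mdeg m' i)"
proof
  fix i
  let ?A = "Poly_Mapping.keys m \<union> Poly_Mapping.keys m'"
  have "mdeg (m + m') i = (\<Sum>x | x \<in> ?A \<and> fst x = i. Poly_Mapping.lookup (m + m') x)"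
    using Poly_Mapping.keys_add[of m m'] by (intro mdeg_superset) auto
  then show "mdeg (m + m') i = mdeg m i + mdeg m' i"
    by (simp add: lookup_add sum.distrib mdeg_superset[of ?A])
qed

definition homogeneous :: "(nat \<Rightarrow> nat) \<Rightarrow> 'k::comm_ring_1 mpoly \<Rightarrow> bool" where
  "homogeneous d F \<longleftrightarrow> (\<forall>m \<in> Poly_Mapping.keys F. mdeg m = d)"

definition component :: "(nat \<Rightarrow> nat) \<Rightarrow> 'k::comm_ring_1 mpoly \<Rightarrow> 'k mpoly" where
  "component d F = (\<Sum>m | m \<in> Poly_Mapping.keys F \<and> mdeg m = d.
     Poly_Mapping.single m (Poly_Mapping.lookup F m))"

lemma lookup_component: "Poly_Mapping.lookup (component d F) m = (if mdeg m = d then Poly_Mapping.lookup F m else 0)"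
  by (auto simp: component_def lookup_sum lookup_single when_def not_in_keys_iff_lookup_eq_zero)

lemma component_zero [simp]: "component d 0 = 0"
  by (simp add: component_def)

lemma component_add: "component d (F + G) = component d F + component d G"
  by (rule poly_mapping_eqI) (simp add: lookup_component lookup_add)

lemma component_diff: "component d (F - G) = component d F - component d G"
  by (rule poly_mapping_eqI) (simp add: lookup_component lookup_minus)

lemma component_sum: "component d (\<Sum>x \<in> A. f x) = (\<Sum>x \<in> A. component d (f x))"
  by (induction A rule: infinite_finite_induct) (auto simp: component_add)

lemma component_single: "component d (Poly_Mapping.single m c) = (if mdeg m = d then Poly_Mapping.single m c else 0)"
  by (rule poly_mapping_eqI) (auto simp: lookup_component lookup_single when_def)

lemma component_homogeneous: "homogeneous d F \<Longrightarrow> component d F = F"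
  by (rule poly_mapping_eqI) (auto simp: lookup_component homogeneous_def in_keys_iff)

lemma homogeneous_component: "homogeneous d (component d F)"
  by (auto simp: homogeneous_def in_keys_iff lookup_component split: if_splits)

text \<open>
  A form shifts the grading, which allows components of a product to be read off. Both this and the next
  lemma reduce to monomials by bilinearity.
\<close>

lemma component_mult:
  assumes "homogeneous e H"
  shows "component (\<lambda>i. e i + d i) (H * F) = H * component d F"
proof -
  have eq: "mdeg (m + m') = (\<lambda>i. e i + d i) \<longleftrightarrow> mdeg m' = d"
    if "m \<in> Poly_Mapping.keys H" for m m'
    using that assms by (auto simp: homogeneous_def mdeg_add fun_eq_iff)
  have "component (\<lambda>i. e i + d i) (H * F) =
      (\<Sum>m \<in> Poly_Mapping.keys H. \<Sum>m' \<in> Poly_Mapping.keys F.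
        component (\<lambda>i. e i + d i) (Poly_Mapping.single (m + m') (Poly_Mapping.lookup H m * Poly_Mapping.lookup F m')))"
    by (subst poly_mapping_eq_sum_single[of H], subst poly_mapping_eq_sum_single[of F])
      (simp add: sum_product component_sum mult_single)
  also have "\<dots> = (\<Sum>m \<in> Poly_Mapping.keys H. \<Sum>m' \<in> Poly_Mapping.keys F.
        Poly_Mapping.single m (Poly_Mapping.lookup H m) *
          component d (Poly_Mapping.single m' (Poly_Mapping.lookup F m')))"
    by (intro sum.cong refl) (auto simp: component_single eq mult_single)
  also have "\<dots> = H * component d F"
    unfolding sum_product[symmetric] component_sum[symmetric]
    by (simp flip: poly_mapping_eq_sum_single)
  finally show ?thesis .
qed

lemma component_mult_eq_0:
  assumes "homogeneous e H" "\<not> e \<le> d"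
  shows "component d (H * F) = 0"
proof -
  have neq: "mdeg (m + m') \<noteq> d" if "m \<in> Poly_Mapping.keys H" for m m'
    using that assms by (auto simp: homogeneous_def mdeg_add le_fun_def)
  have "component d (H * F) =
      (\<Sum>m \<in> Poly_Mapping.keys H. \<Sum>m' \<in> Poly_Mapping.keys F.
        component d (Poly_Mapping.single (m + m') (Poly_Mapping.lookup H m * Poly_Mapping.lookup F m')))"
    by (subst poly_mapping_eq_sum_single[of H], subst poly_mapping_eq_sum_single[of F])
      (simp add: sum_product component_sum mult_single)
  also have "\<dots> = 0"
    by (intro sum.neutral ballI) (simp add: component_single neq)
  finally show ?thesis .
qed

lemma mem_coord_ring: "F \<in> carrier (coord_ring r n) \<longleftrightarrow>
    (\<forall>m \<in> Poly_Mapping.keys F. Poly_Mapping.keys m \<subseteq> mvars r n)"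
  by (simp add: coord_ring_def)

lemma coord_ring_simps [simp]:
  "\<zero>\<^bsub>coord_ring r n\<^esub> = 0" "\<one>\<^bsub>coord_ring r n\<^esub> = 1"
  "F \<oplus>\<^bsub>coord_ring r n\<^esub> G = F + G" "F \<otimes>\<^bsub>coord_ring r n\<^esub> G = F * G"
  by (simp_all add: coord_ring_def)

lemma coord_ring_uminus:
  "F \<in> carrier (coord_ring r n) \<Longrightarrow> - F \<in> carrier (coord_ring r n)"
  by (simp add: mem_coord_ring)

lemma ring_subset_coord_ring: "ring_subset (carrier (coord_ring r n :: 'k::comm_ring_1 mpoly ring))"
proof -
  interpret R: cring "coord_ring r n :: 'k mpoly ring" by (rule cring_coord_ring)
  show ?thesis
  proof
    show "1 \<in> carrier (coord_ring r n :: 'k mpoly ring)" using R.one_closed by simp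
    fix a b :: "'k mpoly" assume ab: "a \<in> carrier (coord_ring r n)" "b \<in> carrier (coord_ring r n)"
    then show "a * b \<in> carrier (coord_ring r n)" using R.m_closed by simp
    show "a - b \<in> carrier (coord_ring r n)"
      using R.a_closed[OF ab(1) coord_ring_uminus[OF ab(2)]] by simp
  qed
qed

lemma coord_ring_ideal_iff:
  "ideal J (coord_ring r n) \<longleftrightarrow> ring_subset.is_ideal (carrier (coord_ring r n :: 'k::comm_ring_1 mpoly ring)) J"
proof -
  interpret R: cring "coord_ring r n :: 'k mpoly ring" by (rule cring_coord_ring)
  interpret C: ring_subset "carrier (coord_ring r n :: 'k mpoly ring)" by (rule ring_subset_coord_ring)
  have minus: "\<ominus>\<^bsub>coord_ring r n\<^esub> a = - a" if "a \<in> carrier (coord_ring r n)" for a :: "'k mpoly"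
    using that coord_ring_uminus by (intro R.minus_equality) auto
  show ?thesis
  proof
    assume "ideal J (coord_ring r n)"
    then interpret J: ideal J "coord_ring r n :: 'k mpoly ring" .
    have "a - b \<in> J" if "a \<in> J" "b \<in> J" for a b
      using J.a_closed[OF that(1) J.a_inv_closed[OF that(2)]] minus[OF J.a_Hcarr[OF that(2)]] by simp
    then show "C.is_ideal J"
      using J.a_subset J.zero_closed J.I_l_closed unfolding C.is_ideal_def by auto
  next
    assume J: "C.is_ideal J"
    show "ideal J (coord_ring r n)"
    proof (rule idealI)
      show "subgroup J (add_monoid (coord_ring r n))"
      proof (rule R.add.subgroupI)
        fix a assume a: "a \<in> J"
        have "\<ominus>\<^bsub>coord_ring r n\<^esub> a = - a" using J a by (intro minus C.ideal_subset)
        then show "\<ominus>\<^bsub>coord_ring r n\<^esub> a \<in> J" using C.ideal_uminus[OF J a] by simp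
      qed (use J in \<open>auto simp: C.ideal_add C.ideal_subset dest: C.ideal_zero\<close>)
    next
      fix a x :: "'k mpoly" assume "a \<in> J" "x \<in> carrier (coord_ring r n)"
      then show "a \<otimes>\<^bsub>coord_ring r n\<^esub> x \<in> J"
        using C.ideal_mult[OF J, of x a] by (simp add: mult.commute)
    qed (use J in \<open>auto simp: C.ideal_mult R.ring_axioms\<close>)
  qed
qed

lemma mvar_carrier: "x \<in> mvars r n \<Longrightarrow> mvar x \<in> carrier (coord_ring r n)"
  by (simp add: mem_coord_ring mvar_def)

lemma component_carrier: "F \<in> carrier (coord_ring r n) \<Longrightarrow> component d F \<in> carrier (coord_ring r n)"
  by (auto simp: mem_coord_ring in_keys_iff lookup_component split: if_splits)

lemma multiform_iff: "multiform r n d F \<longleftrightarrow> F \<in> carrier (coord_ring r n) \<and> homogeneous d F"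
  by (simp add: multiform_def homogeneous_def)

lemma homogeneous_add: "homogeneous d F \<Longrightarrow> homogeneous d G \<Longrightarrow> homogeneous d (F + G)"
  using Poly_Mapping.keys_add[of F G] by (auto simp: homogeneous_def)

lemma homogeneous_zero [simp]: "homogeneous d 0"
  by (simp add: homogeneous_def)

lemma homogeneous_sum: "(\<And>x. x \<in> A \<Longrightarrow> homogeneous d (f x)) \<Longrightarrow> homogeneous d (\<Sum>x \<in> A. f x)"
  by (induction A rule: infinite_finite_induct) (auto simp: homogeneous_add)

lemma homogeneous_uminus: "homogeneous d F \<Longrightarrow> homogeneous d (- F)"
  by (simp add: homogeneous_def)

lemma homogeneous_diff: "homogeneous d F \<Longrightarrow> homogeneous d G \<Longrightarrow> homogeneous d (F - G)"
  using homogeneous_add[of d F "- G"] homogeneous_uminus[of d G] by simp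

lemma homogeneous_mult: "homogeneous d F \<Longrightarrow> homogeneous e G \<Longrightarrow> homogeneous (\<lambda>i. d i + e i) (F * G)"
  using keys_mult[of F G] by (fastforce simp: homogeneous_def mdeg_add)

lemma homogeneous_const: "homogeneous (\<lambda>_. 0) (Poly_Mapping.single 0 c)"
  by (simp add: homogeneous_def mdeg_def)

lemma homogeneous_one: "homogeneous (\<lambda>_. 0) 1"
  using homogeneous_const[of 1] by simp

lemma homogeneous_power: "homogeneous d F \<Longrightarrow> homogeneous (\<lambda>i. k * d i) (F ^ k)"
  by (induction k) (use homogeneous_one homogeneous_mult[of d F] in \<open>force+\<close>)

lemma homogeneous_prod:
  "(\<And>x. x \<in> A \<Longrightarrow> homogeneous (d x) (f x)) \<Longrightarrow> homogeneous (\<lambda>i. \<Sum>x \<in> A. d x i) (\<Prod>x \<in> A. f x)"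
  by (induction A rule: infinite_finite_induct) (auto simp: homogeneous_one intro: homogeneous_mult)

definition unit_deg :: "nat \<Rightarrow> nat \<Rightarrow> nat" where
  "unit_deg i = (\<lambda>j. if j = i then 1 else 0)"

lemma homogeneous_mvar: "homogeneous (unit_deg i) (mvar (i, j))"
proof -
  have "{x. x = (i, j) \<and> fst x = l} = (if l = i then {(i, j)} else {})" for l by auto
  then show ?thesis by (auto simp: homogeneous_def mvar_def mdeg_def unit_deg_def fun_eq_iff)
qed

section \<open>Sets of points with chosen representatives\<close>

lemma multiproj_space_component:
  assumes "P \<in> multiproj_space r n" "i \<in> {1..r}"
  shows "P i \<in> nonzero_vecs (n i) // proportional (n i)"
  using PiE_mem[of P "{1..r}" "\<lambda>i. proj_space (n i)" i] assms
  by (simp add: multiproj_space_def proj_space_def)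

text \<open>
  Points are sets of proportional vectors, so each is given a representative \<open>v P\<close>. Vanishing of a form at
  \<open>P\<close> becomes vanishing of its value at \<open>v P\<close>, and evaluation there is a ring homomorphism on all
  polynomials.
\<close>

locale multiprojective_points =
  fixes r :: nat and n :: "nat \<Rightarrow> nat" and X :: "'k::field_char_0 mpoint set"
    and v :: "'k mpoint \<Rightarrow> nat \<Rightarrow> nat \<Rightarrow> 'k"
  assumes r_pos: "1 \<le> r" and finite_X: "finite X" and X_subset: "X \<subseteq> multiproj_space r n"
    and v_mem: "P \<in> X \<Longrightarrow> i \<in> {1..r} \<Longrightarrow> v P i \<in> P i"
begin

abbreviation A :: "'k mpoly ring" where "A \<equiv> coord_ring r n"

sublocale A: cring A by (rule cring_coord_ring)

sublocale C: ring_subset "carrier A" by (rule ring_subset_coord_ring)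

definition ev :: "'k mpoint \<Rightarrow> 'k mpoly \<Rightarrow> 'k" where
  "ev P F = mp_eval (\<lambda>(i, j). v P i j) F"

lemma ev_simps [simp]:
  "ev P 0 = 0" "ev P 1 = 1" "ev P (- F) = - ev P F"
  "ev P (F + G) = ev P F + ev P G" "ev P (F - G) = ev P F - ev P G"
  "ev P (F * G) = ev P F * ev P G" "ev P (F ^ k) = ev P F ^ k"
  "ev P (mvar (i, j)) = v P i j" "ev P (Poly_Mapping.single 0 c) = c"
  by (simp_all add: ev_def monomial_value_def)

lemma ev_sum: "ev P (\<Sum>x \<in> S. f x) = (\<Sum>x \<in> S. ev P (f x))"
  by (simp add: ev_def mp_eval_sum)

lemma ev_prod: "ev P (\<Prod>x \<in> S. f x) = (\<Prod>x \<in> S. ev P (f x))"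
  by (simp add: ev_def mp_eval_prod)

lemma vanishes_iff_ev:
  assumes "multiform r n d F" "P \<in> X"
  shows "vanishes_at r F P \<longleftrightarrow> ev P F = 0"
  unfolding ev_def using assms X_subset v_mem by (intro multiform_vanishes_iff) auto

lemma separator_iff_ev:
  assumes "P \<in> X"
  shows "separator r n X P d F \<longleftrightarrow>
    multiform r n d F \<and> ev P F \<noteq> 0 \<and> (\<forall>Q \<in> X - {P}. ev Q F = 0)"
  using assms vanishes_iff_ev unfolding separator_def by blast

lemma v_nonzero:
  assumes "P \<in> X" "i \<in> {1..r}"
  shows "v P i \<in> nonzero_vecs (n i)"
proof -
  have "P i \<in> nonzero_vecs (n i) // proportional (n i)"
    using X_subset assms by (intro multiproj_space_component) auto
  then show ?thesis
    using in_quotient_imp_subset[OF equiv_proportional] v_mem[OF assms] by blast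
qed

lemma v_coordinate:
  assumes "P \<in> X" "i \<in> {1..r}"
  shows "\<exists>j \<le> n i. v P i j \<noteq> 0"
  using v_nonzero[OF assms] by (auto simp: nonzero_vecs_def)

text \<open>
  These are the polynomials all of whose components vanish on \<open>X\<close>. The ideal of \<open>X\<close> is generated by such
  polynomials, hence consists of them; so it is a homogeneous ideal whose forms vanish on \<open>X\<close>.
\<close>

lemma is_ideal_component_vanishing:
  "C.is_ideal {F \<in> carrier A. \<forall>P \<in> X. \<forall>d. ev P (component d F) = 0}" (is "C.is_ideal ?W")
proof -
  have "G * F \<in> ?W" if G: "G \<in> carrier A" and F: "F \<in> ?W" for F G
  proof -
    have monomial_case: "ev P (component d (Poly_Mapping.single m c * F)) = 0" if P: "P \<in> X" for P d m c
    proof (cases "mdeg m \<le> d")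
      case True
      then have "d = (\<lambda>i. mdeg m i + (d i - mdeg m i))" by (auto simp: le_fun_def)
      then have "component d (Poly_Mapping.single m c * F) =
          Poly_Mapping.single m c * component (\<lambda>i. d i - mdeg m i) F"
        using component_mult[of "mdeg m" "Poly_Mapping.single m c" "\<lambda>i. d i - mdeg m i" F]
        by (simp add: homogeneous_def)
      then show ?thesis using F P by simp
    next
      case False
      then show ?thesis
        using component_mult_eq_0[of "mdeg m" "Poly_Mapping.single m c" d F]
        by (simp add: homogeneous_def)
    qed
    have "ev P (component d (G * F)) = 0" if "P \<in> X" for P d
      by (subst poly_mapping_eq_sum_single[of G])
        (simp add: sum_distrib_right component_sum ev_sum monomial_case that)
    then show ?thesis using F G by (auto intro: C.closed)
  qed
  then show ?thesis
    unfolding C.is_ideal_def by (auto simp: component_diff intro: C.closed)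
qed

abbreviation I_X :: "'k mpoly set" where "I_X \<equiv> vanishing_ideal r n X"

lemma forms_subset:
  "{F. (\<exists>d. multiform r n d F) \<and> (\<forall>P \<in> X. vanishes_at r F P)} \<subseteq> carrier A"
  by (auto simp: multiform_def)

lemma ideal_I_X: "ideal I_X A"
  unfolding vanishing_ideal_def by (rule A.genideal_ideal[OF forms_subset])

lemma is_ideal_I_X: "C.is_ideal I_X"
  using ideal_I_X by (simp add: coord_ring_ideal_iff)

lemma vanishing_idealI:
  assumes "F \<in> carrier A" "homogeneous d F" "\<And>P. P \<in> X \<Longrightarrow> ev P F = 0"
  shows "F \<in> I_X"
  unfolding vanishing_ideal_def
  using assms vanishes_iff_ev[of d F]
  by (intro subsetD[OF A.genideal_self[OF forms_subset]]) (auto simp: multiform_iff)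

lemma vanishing_ideal_component:
  assumes "F \<in> I_X" "P \<in> X"
  shows "ev P (component d F) = 0"
proof -
  have "ev Q (component e G) = 0" if G: "multiform r n d' G" "\<forall>P \<in> X. vanishes_at r G P" "Q \<in> X" for G d' Q e
  proof (cases "e = d'")
    case True
    then show ?thesis using G vanishes_iff_ev by (auto simp: multiform_iff component_homogeneous)
  next
    case False
    then have "component e G = 0"
      using G by (intro poly_mapping_eqI) (auto simp: lookup_component multiform_iff homogeneous_def in_keys_iff)
    then show ?thesis by simp
  qed
  then have "I_X \<subseteq> {F \<in> carrier A. \<forall>P \<in> X. \<forall>d. ev P (component d F) = 0}"
    unfolding vanishing_ideal_def
    by (intro A.genideal_minimal) (auto simp: coord_ring_ideal_iff is_ideal_component_vanishing multiform_def)
  then show ?thesis using assms by blast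
qed

lemma const_carrier: "Poly_Mapping.single 0 c \<in> carrier A"
  by (simp add: mem_coord_ring)

lemma var_carrier: "i \<in> {1..r} \<Longrightarrow> j \<le> n i \<Longrightarrow> mvar (i, j) \<in> carrier A"
  by (intro mvar_carrier) (auto simp: mvars_def)

lemma homogeneous_const_mult: "homogeneous d F \<Longrightarrow> homogeneous d (Poly_Mapping.single 0 c * F)"
  using homogeneous_mult[OF homogeneous_const, of d F c] by simp

text \<open>
  The linear form with coefficients \<open>1, t, t\<^sup>2, \<dots>\<close> has at each point of \<open>X\<close> a value that is a nonzero
  polynomial in \<open>t\<close>. Finitely many such polynomials have only finitely many roots.
\<close>

lemma exists_nonvanishing_linear_form:
  assumes i: "i \<in> {1..r}"
  shows "\<exists>L. multiform r n (unit_deg i) L \<and> (\<forall>P \<in> X. ev P L \<noteq> 0)"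
proof -
  define p where "p P = (\<Sum>j \<le> n i. monom (v P i j) j)" for P
  have "p P \<noteq> 0" if P: "P \<in> X" for P
  proof -
    obtain j where j: "j \<le> n i" "v P i j \<noteq> 0"
      using v_coordinate[OF P i] by blast
    then have "coeff (p P) j = v P i j"
      by (simp add: p_def coeff_sum coeff_monom if_distrib cong: if_cong)
    then show ?thesis using j by auto
  qed
  then have "(\<Prod>P \<in> X. p P) \<noteq> 0" using finite_X by simp
  then have "finite {t. poly (\<Prod>P \<in> X. p P) t = 0}" by (rule poly_roots_finite)
  then obtain t where "poly (\<Prod>P \<in> X. p P) t \<noteq> 0"
    using infinite_UNIV_char_0[where 'a='k] by (metis (mono_tags) UNIV_I ex_new_if_finite mem_Collect_eq)
  then have t: "poly (p P) t \<noteq> 0" if "P \<in> X" for P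
    using that finite_X by (auto simp: poly_prod)
  define L where "L = (\<Sum>j \<le> n i. Poly_Mapping.single 0 (t ^ j) * mvar (i, j))"
  have "ev P L = poly (p P) t" for P
    by (simp add: L_def p_def ev_sum poly_sum poly_monom mult.commute)
  moreover have "L \<in> carrier A"
    unfolding L_def using i by (intro C.closed const_carrier var_carrier) auto
  moreover have "homogeneous (unit_deg i) L"
    unfolding L_def by (intro homogeneous_sum homogeneous_const_mult homogeneous_mvar)
  ultimately show ?thesis using t by (auto simp: multiform_iff)
qed

text \<open>
  Two distinct points differ in some factor, and a two by two minor of coordinates in that factor is a
  linear form vanishing at one of the points and not at the other. The separator is the product of
  these forms.
\<close>

lemma exists_separator:
  assumes P: "P \<in> X"
  shows "\<exists>d F. separator r n X P d F"
proof -
  have "\<exists>d G. multiform r n d G \<and> ev P G \<noteq> 0 \<and> ev Q G = 0" if Q: "Q \<in> X - {P}" for Q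
  proof -
    have "\<exists>i \<in> {1..r}. P i \<noteq> Q i"
    proof (rule ccontr)
      assume "\<not> ?thesis"
      moreover have "P \<in> multiproj_space r n" "Q \<in> multiproj_space r n" using P Q X_subset by auto
      ultimately have "P = Q" unfolding multiproj_space_def by (intro PiE_ext) blast+
      then show False using Q by simp
    qed
    then obtain i where i: "i \<in> {1..r}" "P i \<noteq> Q i" by blast
    have "\<exists>a b. a \<le> n i \<and> b \<le> n i \<and> v Q i a * v P i b \<noteq> v Q i b * v P i a"
    proof (rule ccontr)
      assume "\<not> ?thesis"
      then have eq: "v Q i a * v P i b = v Q i b * v P i a" if "a \<le> n i" "b \<le> n i" for a b
        using that by blast
      obtain a where a: "a \<le> n i" "v Q i a \<noteq> 0"
        using v_coordinate[of Q i] Q i by blast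
      define c where "c = v P i a / v Q i a"
      have c: "v P i b = c * v Q i b" if "b \<le> n i" for b
        using eq[OF a(1) that] a by (simp add: c_def field_simps)
      moreover obtain b where "b \<le> n i" "v P i b \<noteq> 0"
        using v_coordinate[of P i] P i by blast
      ultimately have "c \<noteq> 0" by auto
      then have "(v Q i, v P i) \<in> proportional (n i)"
        using c v_nonzero P Q i by (auto simp: proportional_def intro!: exI[of _ c])
      moreover have "Q i \<in> nonzero_vecs (n i) // proportional (n i)"
        "P i \<in> nonzero_vecs (n i) // proportional (n i)"
        using multiproj_space_component[OF _ i(1)] X_subset P Q by blast+
      ultimately have "Q i = P i"
        using quotient_eq_iff[OF equiv_proportional] v_mem P Q i by blast
      then show False using i by simp
    qed
    then obtain a b where ab: "a \<le> n i" "b \<le> n i" "v Q i a * v P i b \<noteq> v Q i b * v P i a" by blast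
    define G where "G = Poly_Mapping.single 0 (v Q i a) * mvar (i, b) - Poly_Mapping.single 0 (v Q i b) * mvar (i, a)"
    have "G \<in> carrier A" unfolding G_def using i ab by (intro C.closed const_carrier var_carrier)
    moreover have "homogeneous (unit_deg i) G"
      unfolding G_def by (intro homogeneous_diff homogeneous_const_mult homogeneous_mvar)
    ultimately show ?thesis
      using ab by (intro exI[of _ "unit_deg i"] exI[of _ G]) (auto simp: multiform_iff G_def)
  qed
  then obtain d G where G: "\<And>Q. Q \<in> X - {P} \<Longrightarrow> multiform r n (d Q) (G Q)"
    "\<And>Q. Q \<in> X - {P} \<Longrightarrow> ev P (G Q) \<noteq> 0" "\<And>Q. Q \<in> X - {P} \<Longrightarrow> ev Q (G Q) = 0"
    by metis
  define F where "F = (\<Prod>Q \<in> X - {P}. G Q)"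
  have "F \<in> carrier A"
    unfolding F_def using G(1) by (intro C.prod_closed) (auto simp: multiform_iff)
  moreover have "homogeneous (\<lambda>i. \<Sum>Q \<in> X - {P}. d Q i) F"
    unfolding F_def using G(1) by (intro homogeneous_prod) (auto simp: multiform_iff)
  moreover have "ev P F \<noteq> 0" using finite_X G(2) by (simp add: F_def ev_prod)
  moreover have "ev Q F = 0" if "Q \<in> X - {P}" for Q
    using finite_X G(3)[OF that] that by (auto simp: F_def ev_prod)
  ultimately show ?thesis using separator_iff_ev[OF P] multiform_iff by metis
qed

text \<open>
  For each \<open>P\<close>, a suitable multiple of \<open>L\<close> takes the same value at \<open>P\<close> as the power \<open>x\<^sup>e\<close> of the variable,
  which has the same degree. The product of the differences vanishes on \<open>X\<close> and is congruent to a power of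
  \<open>x\<close> modulo \<open>L\<close>.
\<close>

lemma var_power_mod:
  assumes i: "i \<in> {1..r}" "j \<le> n i"
    and L: "L \<in> carrier A" "homogeneous (\<lambda>k. e * unit_deg i k) L" "\<And>P. P \<in> X \<Longrightarrow> ev P L \<noteq> 0"
  shows "\<exists>k. \<exists>c \<in> carrier A. mvar (i, j) ^ k - c * L \<in> I_X"
proof -
  let ?x = "mvar (i, j) ^ e :: 'k mpoly"
  define a :: "'k mpoint \<Rightarrow> 'k mpoly"
    where "a P = Poly_Mapping.single 0 (v P i j ^ e / ev P L)" for P
  have x: "?x \<in> carrier A" using i by (intro C.closed var_carrier)
  have "homogeneous (\<lambda>k. e * unit_deg i k) ?x" by (intro homogeneous_power homogeneous_mvar)
  then have "homogeneous (\<lambda>k. e * unit_deg i k) (?x - a P * L)" for P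
    unfolding a_def by (intro homogeneous_diff homogeneous_const_mult L)
  then have "homogeneous (\<lambda>k. \<Sum>P \<in> X. e * unit_deg i k) (\<Prod>P \<in> X. ?x - a P * L)"
    by (intro homogeneous_prod)
  moreover have "(\<Prod>P \<in> X. ?x - a P * L) \<in> carrier A"
    using L by (intro C.prod_closed C.diff_closed C.mult_closed x) (auto simp: a_def const_carrier)
  moreover have "ev Q (\<Prod>P \<in> X. ?x - a P * L) = 0" if "Q \<in> X" for Q
    using that finite_X L(3)[OF that] by (auto simp: ev_prod a_def intro!: bexI[of _ Q])
  ultimately have I: "(\<Prod>P \<in> X. ?x - a P * L) \<in> I_X" by (intro vanishing_idealI)
  have "\<exists>c \<in> carrier A. (\<Prod>P \<in> Y. ?x - a P * L) = ?x ^ card Y - c * L" if "finite Y" for Y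
    using that
  proof (induction Y)
    case empty
    show ?case using C.zero_closed by (intro bexI[of _ 0]) auto
  next
    case (insert P Y)
    then obtain c where c: "c \<in> carrier A" "(\<Prod>P \<in> Y. ?x - a P * L) = ?x ^ card Y - c * L" by blast
    have "(\<Prod>P \<in> insert P Y. ?x - a P * L) = (?x - a P * L) * (?x ^ card Y - c * L)"
      using insert.hyps c(2) by simp
    also have "\<dots> = ?x ^ card (insert P Y) - (?x * c + a P * (?x ^ card Y - c * L)) * L"
      using insert.hyps by (simp add: algebra_simps)
    finally have "(\<Prod>P \<in> insert P Y. ?x - a P * L) =
      ?x ^ card (insert P Y) - (?x * c + a P * (?x ^ card Y - c * L)) * L" .
    moreover have "?x * c + a P * (?x ^ card Y - c * L) \<in> carrier A"
      unfolding a_def using i c L by (intro C.closed const_carrier var_carrier)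
    ultimately show ?case by blast
  qed
  then obtain c where "c \<in> carrier A" "(\<Prod>P \<in> X. ?x - a P * L) = ?x ^ card X - c * L"
    using finite_X by blast
  then show ?thesis
    using I by (intro exI[of _ "e * card X"]) (auto simp: power_mult)
qed

text \<open>
  By \<open>var_power_mod\<close> the ideal generated by the \<open>l\<^sub>i\<close> and the ideal of \<open>X\<close> has a radical containing all
  variables, hence all members of a regular sequence of length \<open>r\<close> in the irrelevant ideal. So
  \<open>regular_sequence_koszul_exact\<close> applies.
\<close>

lemma ACM_koszul_exact:
  assumes ACM: "ACM r n X"
    and l: "\<And>i. i \<in> {1..r} \<Longrightarrow> l i \<in> carrier A"
      "\<And>i. i \<in> {1..r} \<Longrightarrow> homogeneous (\<lambda>k. e i * unit_deg i k) (l i)"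
      "\<And>i P. i \<in> {1..r} \<Longrightarrow> P \<in> X \<Longrightarrow> ev P (l i) \<noteq> 0"
  shows "C.koszul_exact {1..r} l I_X 0"
proof -
  let ?h = "\<lambda>a. I_X +>\<^bsub>A\<^esub> a"
  define K where "K = {x \<in> carrier A. \<exists>c. (\<forall>a \<in> {1..r}. c a \<in> carrier A) \<and>
    x - (\<Sum>a \<in> {1..r}. c a * l a) \<in> I_X}"
  define Rad where "Rad = {x \<in> carrier A. \<exists>k. x ^ k \<in> K}"
  have "C.is_ideal K"
    unfolding K_def using l by (intro C.is_ideal_linear_span is_ideal_I_X) auto
  then have "C.is_ideal Rad" unfolding Rad_def by (rule C.is_ideal_radical)
  then have idealRad: "ideal Rad A" by (simp add: coord_ring_ideal_iff)
  have var: "mvar x \<in> Rad" if x: "x \<in> mvars r n" for x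
  proof -
    obtain i j where ij: "x = (i, j)" "i \<in> {1..r}" "j \<le> n i" using x by (auto simp: mvars_def)
    obtain k c where c: "c \<in> carrier A" "mvar x ^ k - c * l i \<in> I_X"
      using var_power_mod[of i j "l i" "e i"] ij l by blast
    have "(\<Sum>a \<in> {1..r}. (if a = i then c else 0) * l a) = (\<Sum>a \<in> {1..r}. if a = i then c * l i else 0)"
      by (intro sum.cong) auto
    also have "\<dots> = c * l i" using ij by simp
    finally have "mvar x ^ k - (\<Sum>a \<in> {1..r}. (if a = i then c else 0) * l a) \<in> I_X" using c by simp
    moreover have "\<forall>a \<in> {1..r}. (if a = i then c else 0) \<in> carrier A"
      using c C.zero_closed by auto
    ultimately have "mvar x ^ k \<in> K"
      unfolding K_def using C.power_closed[OF mvar_carrier[OF x]] by (intro CollectI conjI exI)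
    then show ?thesis unfolding Rad_def using mvar_carrier[OF x] by blast
  qed
  have "irrelevant_ideal r n X \<subseteq> ?h ` Rad"
  proof -
    interpret I: ideal I_X A by (rule ideal_I_X)
    interpret Q: ring "point_ring r n X" unfolding point_ring_def by (rule I.quotient_is_ring)
    have "ideal (?h ` Rad) (point_ring r n X)"
      unfolding point_ring_def by (rule A.ring_ideal_imp_quot_ideal[OF ideal_I_X idealRad])
    then show ?thesis
      unfolding irrelevant_ideal_def by (rule Q.genideal_minimal) (use var in auto)
  qed
  moreover have "enat r \<in> {enat (length xs) | xs. regular_seq (point_ring r n X) xs \<and>
      set xs \<subseteq> irrelevant_ideal r n X}"
    using ACM r_pos unfolding ACM_def ring_depth_def by (intro Sup_enat_eq_attained) auto
  ultimately obtain xs where xs: "length xs = r" "regular_seq (A Quot I_X) xs" "set xs \<subseteq> ?h ` Rad"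
    unfolding point_ring_def by auto
  have "\<exists>y. y \<in> Rad \<and> xs ! i = ?h y" if "i < r" for i
  proof -
    have "xs ! i \<in> ?h ` Rad" using xs that nth_mem by blast
    then show ?thesis by blast
  qed
  then obtain y where y: "\<And>i. i < r \<Longrightarrow> y i \<in> Rad" "\<And>i. i < r \<Longrightarrow> xs ! i = ?h (y i)" by metis
  have yA: "y i \<in> carrier A" if "i < r" for i using y(1)[OF that] by (simp add: Rad_def)
  have y': "y i \<in> carrier A \<and> xs ! i = ?h (y i)" if "i < length xs" for i
    using that yA y(2) xs(1) by simp
  obtain J where J: "J 0 = I_X" "\<And>i. ideal (J i) A"
    "\<And>i. i < length xs \<Longrightarrow> J (Suc i) = J i <+>\<^bsub>A\<^esub> PIdl\<^bsub>A\<^esub> (y i)"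
    "\<And>i a. i < length xs \<Longrightarrow> a \<in> carrier A \<Longrightarrow> y i \<otimes>\<^bsub>A\<^esub> a \<in> J i \<Longrightarrow> a \<in> J i"
    using A.regular_seq_quotient_lift[OF ideal_I_X xs(2) y'] by metis
  have "C.koszul_exact {1..r} l (J 0) 0"
  proof (rule C.regular_sequence_koszul_exact)
    fix i assume i: "i < card {1..r}"
    show "J (Suc i) = C.adjoin (J i) (y i)"
      using i J(3)[of i] xs(1)
      by (auto simp: C.adjoin_def set_add_def' cgenideal_def mult.commute) 
    show "\<exists>k c. (\<forall>a \<in> {1..r}. c a \<in> carrier A) \<and> y i ^ k - (\<Sum>a \<in> {1..r}. c a * l a) \<in> J 0"
      using y(1)[of i] i by (auto simp: Rad_def K_def J(1))
    show "y i \<in> carrier A" using yA i by simp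
    show "a \<in> J i" if "a \<in> carrier A" "y i * a \<in> J i" for a
      using J(4)[of i a] that i xs(1) by simp
  qed (use l J(2) in \<open>auto simp: coord_ring_ideal_iff\<close>)
  then show ?thesis by (simp add: J(1))
qed

text \<open>
  With \<open>L\<^sub>i, L\<^sub>j\<close> nonvanishing on \<open>X\<close>, multiples of \<open>F\<close> and \<open>G\<close> by constants satisfy \<open>L\<^sub>j F' = L\<^sub>i G'\<close> on
  \<open>X\<close>, both sides being zero away from \<open>P\<close>. This relation is a Koszul cycle. Exactness makes \<open>F'\<close> divisible
  by \<open>L\<^sub>i\<close> in degree \<open>m + e\<^sub>i\<close> modulo the ideal of \<open>X\<close>, and the quotient is the separator of degree \<open>m\<close>.
\<close>

lemma separator_meet:
  assumes ACM: "ACM r n X" and P: "P \<in> X" and ij: "i \<in> {1..r}" "j \<in> {1..r}" "i \<noteq> j"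
    and F: "separator r n X P (\<lambda>k. m k + unit_deg i k) F"
    and G: "separator r n X P (\<lambda>k. m k + unit_deg j k) G"
  shows "\<exists>H. separator r n X P m H"
proof -
  obtain L where L: "\<And>k. k \<in> {1..r} \<Longrightarrow> multiform r n (unit_deg k) (L k)"
    "\<And>k Q. k \<in> {1..r} \<Longrightarrow> Q \<in> X \<Longrightarrow> ev Q (L k) \<noteq> 0"
    using exists_nonvanishing_linear_form by metis
  \<comment> \<open>The exponents for k different from i and j exceed m k, so that multiples of these powers
      have no component in degree m + e_i.\<close>
  define e where "e k = (if k = i \<or> k = j then 1 else Suc (m k))" for k
  define l where "l k = L k ^ e k" for k
  have lA: "l k \<in> carrier A" if "k \<in> {1..r}" for k
    unfolding l_def using L(1)[OF that] by (intro C.closed) (simp add: multiform_iff)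
  have lhom: "homogeneous (\<lambda>a. e k * unit_deg k a) (l k)" if "k \<in> {1..r}" for k
    unfolding l_def using L(1)[OF that] by (intro homogeneous_power) (simp add: multiform_iff)
  have lnz: "ev Q (l k) \<noteq> 0" if "k \<in> {1..r}" "Q \<in> X" for k Q
    unfolding l_def using L(2)[OF that] by simp
  have exact: "C.koszul_exact {1..r} l I_X 0"
    by (rule ACM_koszul_exact[OF ACM lA lhom lnz])
  have l_ij: "l i = L i" "l j = L j" by (auto simp: l_def e_def)
  have F1: "F \<in> carrier A" "homogeneous (\<lambda>k. m k + unit_deg i k) F" "ev P F \<noteq> 0"
      "\<And>Q. Q \<in> X - {P} \<Longrightarrow> ev Q F = 0"
    and G1: "G \<in> carrier A" "homogeneous (\<lambda>k. m k + unit_deg j k) G" "ev P G \<noteq> 0"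
      "\<And>Q. Q \<in> X - {P} \<Longrightarrow> ev Q G = 0"
    using F G by (auto simp: separator_iff_ev[OF P] multiform_iff)
  define F' where "F' = Poly_Mapping.single 0 (ev P (L i) * ev P G) * F"
  define G' where "G' = Poly_Mapping.single 0 (ev P (L j) * ev P F) * G"
  have F': "F' \<in> carrier A" "homogeneous (\<lambda>k. m k + unit_deg i k) F'"
    and G': "G' \<in> carrier A" "homogeneous (\<lambda>k. m k + unit_deg j k) G'"
    unfolding F'_def G'_def by (intro C.closed const_carrier homogeneous_const_mult F1 G1)+
  have cycle: "L j * F' - L i * G' \<in> I_X"
  proof (rule vanishing_idealI)
    show "L j * F' - L i * G' \<in> carrier A"
      using L(1) ij F' G' by (intro C.closed) (auto simp: multiform_iff)
    have "homogeneous (\<lambda>k. unit_deg j k + (m k + unit_deg i k)) (L j * F')"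
      using L(1)[OF ij(2)] F'(2) by (intro homogeneous_mult) (auto simp: multiform_iff)
    moreover have "homogeneous (\<lambda>k. unit_deg i k + (m k + unit_deg j k)) (L i * G')"
      using L(1)[OF ij(1)] G'(2) by (intro homogeneous_mult) (auto simp: multiform_iff)
    moreover have "(\<lambda>k. unit_deg i k + (m k + unit_deg j k)) = (\<lambda>k. unit_deg j k + (m k + unit_deg i k))"
      by auto
    ultimately show "homogeneous (\<lambda>k. unit_deg j k + (m k + unit_deg i k)) (L j * F' - L i * G')"
      by (simp add: homogeneous_diff)
    show "ev Q (L j * F' - L i * G') = 0" if "Q \<in> X" for Q
      by (cases "Q = P") (use F1(4) G1(4) that in \<open>auto simp: F'_def G'_def\<close>)
  qed
  \<comment> \<open>The relation between F' and G' as a one-chain; its boundary is the combination in cycle.\<close>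
  define h where "h S = (if S = {j} then F' else if S = {i} then - G' else 0)" for S
  have "koszul_diff {1..r} l h {} = (\<Sum>a \<in> {1..r}. l a * h {a})"
    by (simp add: koszul_diff_def koszul_sign_def)
  also have "\<dots> = (\<Sum>a \<in> {i, j}. l a * h {a})"
    using ij by (intro sum.mono_neutral_right) (auto simp: h_def)
  also have "\<dots> = L j * F' - L i * G'" using ij by (simp add: h_def l_ij)
  finally have dh: "koszul_diff {1..r} l h S \<in> I_X" if "S \<subseteq> {1..r}" "card S = 0" for S
    using cycle that finite_subset[OF that(1)] by simp
  have hA: "h S \<in> carrier A" for S
    unfolding h_def using F' G' by (auto intro: C.closed)
  obtain g where gA: "\<And>S. S \<subseteq> {1..r} \<Longrightarrow> card S = Suc (Suc 0) \<Longrightarrow> g S \<in> carrier A"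
    and g: "\<And>S. S \<subseteq> {1..r} \<Longrightarrow> card S = Suc 0 \<Longrightarrow> h S - koszul_diff {1..r} l g S \<in> I_X"
    by (rule C.koszul_exactD[OF exact, of h]) (use hA dh in blast)+
  define u where "u a = koszul_sign a {j} * g {a, j}" for a
  have "koszul_diff {1..r} l g {j} = (\<Sum>a \<in> {1..r} - {j}. l a * u a)"
    unfolding koszul_diff_def u_def by (intro sum.cong) (auto simp: algebra_simps)
  moreover have "h {j} - koszul_diff {1..r} l g {j} \<in> I_X" using ij by (intro g) auto
  ultimately have I: "F' - (\<Sum>a \<in> {1..r} - {j}. l a * u a) \<in> I_X" by (simp add: h_def)
  define H where "H = component m (u i)"
  let ?d = "\<lambda>k. m k + unit_deg i k"
  have comp: "component ?d (l a * u a) = (if a = i then L i * H else 0)" if "a \<in> {1..r} - {j}" for a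
  proof (cases "a = i")
    case True
    have "component (\<lambda>k. unit_deg i k + m k) (L i * u i) = L i * component m (u i)"
      using L(1)[OF ij(1)] by (intro component_mult) (simp add: multiform_iff)
    then show ?thesis using True by (simp add: H_def l_ij add.commute)
  next
    case False
    have "\<not> e a * unit_deg a a \<le> ?d a" using False that by (simp add: e_def unit_deg_def)
    then have "\<not> (\<lambda>k. e a * unit_deg a k) \<le> ?d" by (auto simp: le_fun_def)
    then show ?thesis using False component_mult_eq_0[OF lhom] that by simp
  qed
  have "component ?d (F' - (\<Sum>a \<in> {1..r} - {j}. l a * u a)) =
      F' - (\<Sum>a \<in> {1..r} - {j}. if a = i then L i * H else 0)"
    using F' by (simp add: component_diff component_sum component_homogeneous comp)
  also have "\<dots> = F' - L i * H" using ij by simp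
  finally have FH: "ev Q F' = ev Q (L i) * ev Q H" if "Q \<in> X" for Q
    using vanishing_ideal_component[OF I that, of ?d] by simp
  have "u i \<in> carrier A" unfolding u_def using ij by (intro C.closed C.koszul_sign_closed gA) auto
  then have "multiform r n m H"
    by (simp add: H_def multiform_iff component_carrier homogeneous_component)
  moreover have "ev P H \<noteq> 0"
    using FH[OF P] L(2)[OF ij(1) P] F1(3) G1(3) by (auto simp: F'_def)
  moreover have "ev Q H = 0" if "Q \<in> X - {P}" for Q
    using FH[of Q] L(2)[OF ij(1), of Q] F1(4)[OF that] that by (auto simp: F'_def)
  ultimately show ?thesis using separator_iff_ev[OF P] by blast
qed

lemma separator_raise:
  assumes P: "P \<in> X" and i: "i \<in> {1..r}" and F: "separator r n X P d F"
  shows "\<exists>G. separator r n X P (\<lambda>k. d k + unit_deg i k) G"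
proof -
  obtain L where L: "multiform r n (unit_deg i) L" "\<forall>P \<in> X. ev P L \<noteq> 0"
    using exists_nonvanishing_linear_form[OF i] by blast
  then have "separator r n X P (\<lambda>k. d k + unit_deg i k) (F * L)"
    using F P by (auto simp: separator_iff_ev multiform_iff intro: C.closed homogeneous_mult)
  then show ?thesis by blast
qed

lemma separator_degree_support:
  assumes P: "P \<in> X" and F: "separator r n X P d F" and k: "k \<notin> {1..r}"
  shows "d k = 0"
proof -
  have FF: "multiform r n d F" "ev P F \<noteq> 0" using F by (auto simp: separator_iff_ev[OF P])
  then have "F \<noteq> 0" by auto
  then obtain m where m: "m \<in> Poly_Mapping.keys F" by (metis ex_in_conv keys_eq_empty)
  then have "mdeg m = d" "Poly_Mapping.keys m \<subseteq> mvars r n"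
    using FF by (auto simp: multiform_def mem_coord_ring)
  then have "{x \<in> Poly_Mapping.keys m. fst x = k} = {}" using k by (auto simp: mvars_def)
  then have "mdeg m k = 0" by (simp only: mdeg_def sum.empty)
  then show ?thesis using \<open>mdeg m = d\<close> by simp
qed

end

section \<open>Minimal degrees of separators\<close>

text \<open>
  Induction on the size of \<open>a\<close> and \<open>b\<close>. If both are nonzero, choose \<open>i\<close> in the support of \<open>a\<close> and \<open>j\<close> in
  the support of \<open>b\<close>. Raising \<open>m\<close> by \<open>e\<^sub>i\<close> shortens \<open>a\<close>, so \<open>m + e\<^sub>i\<close> is in \<open>D\<close> by induction, and likewise
  \<open>m + e\<^sub>j\<close>; the indices differ because the supports are disjoint.
\<close>

lemma exchange_closed_meet:
  fixes D :: "(nat \<Rightarrow> nat) set"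
  assumes S: "finite S"
    and raise: "\<And>d i. d \<in> D \<Longrightarrow> i \<in> S \<Longrightarrow> (\<lambda>k. d k + unit_deg i k) \<in> D"
    and meet: "\<And>m i j. i \<in> S \<Longrightarrow> j \<in> S \<Longrightarrow> i \<noteq> j \<Longrightarrow> (\<lambda>k. m k + unit_deg i k) \<in> D \<Longrightarrow>
      (\<lambda>k. m k + unit_deg j k) \<in> D \<Longrightarrow> m \<in> D"
    and supp: "\<And>k. k \<notin> S \<Longrightarrow> a k = 0" "\<And>k. k \<notin> S \<Longrightarrow> b k = 0"
    and disjoint: "\<And>k. a k = 0 \<or> b k = 0"
    and D: "(\<lambda>k. m k + a k) \<in> D" "(\<lambda>k. m k + b k) \<in> D"
  shows "m \<in> D"
  using supp disjoint D
proof (induction "(\<Sum>k \<in> S. a k) + (\<Sum>k \<in> S. b k)" arbitrary: a b m rule: less_induct)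
  case less
  show ?case
  proof (cases "(\<forall>k. a k = 0) \<or> (\<forall>k. b k = 0)")
    case True
    then show ?thesis using less.prems by auto
  next
    case False
    then obtain i j where i: "a i \<noteq> 0" and j: "b j \<noteq> 0" by blast
    have iS: "i \<in> S" and jS: "j \<in> S" and ij: "i \<noteq> j" using i j less.prems by metis+
    let ?a = "\<lambda>k. a k - unit_deg i k" and ?b = "\<lambda>k. b k - unit_deg j k"
    have lt: "(\<Sum>k \<in> S. f k - unit_deg x k) < (\<Sum>k \<in> S. f k)" if "x \<in> S" "f x \<noteq> 0" for f x
      using that S by (intro sum_strict_mono_ex1) (auto simp: unit_deg_def intro!: bexI[of _ x])
    have "(\<lambda>k. m k + unit_deg i k) \<in> D"
    proof (rule less.hyps[of ?a b])
      have "(\<lambda>k. (m k + unit_deg i k) + ?a k) = (\<lambda>k. m k + a k)"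
        using i by (auto simp: unit_deg_def)
      then show "(\<lambda>k. (m k + unit_deg i k) + ?a k) \<in> D" using less.prems by simp
      show "(\<lambda>k. (m k + unit_deg i k) + b k) \<in> D"
        using raise[OF less.prems(5) iS] by (simp add: ac_simps)
      show "?a k = 0 \<or> b k = 0" for k using less.prems(3)[of k] by auto
    qed (use less.prems lt[of i a] iS i in auto)
    moreover have "(\<lambda>k. m k + unit_deg j k) \<in> D"
    proof (rule less.hyps[of a ?b])
      have "(\<lambda>k. (m k + unit_deg j k) + ?b k) = (\<lambda>k. m k + b k)"
        using j by (auto simp: unit_deg_def)
      then show "(\<lambda>k. (m k + unit_deg j k) + ?b k) \<in> D" using less.prems by simp
      show "(\<lambda>k. (m k + unit_deg j k) + a k) \<in> D"
        using raise[OF less.prems(4) jS] by (simp add: ac_simps)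
      show "a k = 0 \<or> ?b k = 0" for k using less.prems(3)[of k] by auto
    qed (use less.prems lt[of j b] jS j in auto)
    ultimately show ?thesis using meet[OF iS jS ij] by blast
  qed
qed

text \<open>
  An element \<open>d\<close> of \<open>D\<close> with the smallest coordinate sum lies below every \<open>e \<in> D\<close>, since otherwise the
  minimum of \<open>d\<close> and \<open>e\<close> would have a smaller sum.
\<close>

lemma card_min_elems_eq_1:
  fixes D :: "(nat \<Rightarrow> nat) set"
  assumes S: "finite S" and ne: "D \<noteq> {}" and supp: "\<And>d k. d \<in> D \<Longrightarrow> k \<notin> S \<Longrightarrow> d k = 0"
    and inf: "\<And>d e. d \<in> D \<Longrightarrow> e \<in> D \<Longrightarrow> (\<lambda>k. min (d k) (e k)) \<in> D"
  shows "card (min_elems D) = 1"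
proof -
  define w where "w d = (\<Sum>k \<in> S. d k)" for d :: "nat \<Rightarrow> nat"
  define d where "d = arg_min w (\<lambda>d. d \<in> D)"
  have d: "d \<in> D" "\<And>e. e \<in> D \<Longrightarrow> w d \<le> w e"
    unfolding d_def using ne arg_min_natI[of "\<lambda>d. d \<in> D" _ w] arg_min_nat_le[of "\<lambda>d. d \<in> D" _ w]
    by blast+
  have le: "d \<le> e" if e: "e \<in> D" for e
  proof (rule le_funI, rule ccontr)
    fix k assume "\<not> d k \<le> e k"
    then have "k \<in> S" "min (d k) (e k) < d k" using supp[OF d(1), of k] by auto
    then have "w (\<lambda>k. min (d k) (e k)) < w d"
      unfolding w_def using S by (intro sum_strict_mono_ex1) auto
    then show False using d(2)[OF inf[OF d(1) e]] by simp
  qed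
  then have "min_elems D = {d}"
    using d(1) by (auto simp: min_elems_def antisym)
  then show ?thesis by simp
qed

theorem theorem1p3:
  fixes r :: nat and n :: "nat \<Rightarrow> nat"
    and X :: "'k::{alg_closed_field, field_char_0} mpoint set"
  assumes "1 \<le> r"
    and "\<forall>i \<in> {1..r}. 1 \<le> n i"
    and "finite X"
    and "X \<subseteq> multiproj_space r n"
    and "ACM r n X"
  shows "\<forall>P \<in> X. card (point_degree r n X P) = 1"
proof
  fix P assume P: "P \<in> X"
  have "\<exists>x. x \<in> Q i" if "Q \<in> X" "i \<in> {1..r}" for Q i
  proof -
    have "Q i \<in> nonzero_vecs (n i) // proportional (n i)"
      using assms(4) that by (intro multiproj_space_component) auto
    then show ?thesis using in_quotient_imp_non_empty[OF equiv_proportional] by blast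
  qed
  then obtain v where "\<And>Q i. Q \<in> X \<Longrightarrow> i \<in> {1..r} \<Longrightarrow> v Q i \<in> Q i" by metis
  then interpret multiprojective_points r n X v using assms by unfold_locales auto
  define D where "D = {d. \<exists>F. separator r n X P d F}"
  have supp: "d k = 0" if "d \<in> D" "k \<notin> {1..r}" for d k
    using that separator_degree_support[OF P] by (auto simp: D_def)
  have "card (min_elems D) = 1"
  proof (rule card_min_elems_eq_1[of "{1..r}"])
    show "D \<noteq> {}" using exists_separator[OF P] by (auto simp: D_def)
    fix d e assume de: "d \<in> D" "e \<in> D"
    let ?m = "\<lambda>k. min (d k) (e k)"
    show "?m \<in> D"
    proof (rule exchange_closed_meet[of "{1..r}" D "\<lambda>k. d k - ?m k" "\<lambda>k. e k - ?m k"])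
      show "(\<lambda>k. f k + unit_deg i k) \<in> D" if "f \<in> D" "i \<in> {1..r}" for f i
        using separator_raise[OF P] that by (auto simp: D_def)
      show "m \<in> D" if "i \<in> {1..r}" "j \<in> {1..r}" "i \<noteq> j" "(\<lambda>k. m k + unit_deg i k) \<in> D"
        "(\<lambda>k. m k + unit_deg j k) \<in> D" for m i j
        using separator_meet[OF assms(5) P] that unfolding D_def by blast
    qed (use de supp[OF de(1)] supp[OF de(2)] in auto)
  qed (use supp in auto)
  then show "card (point_degree r n X P) = 1" by (simp add: point_degree_def D_def)
qed

end
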